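(* Let $k$ be an algebraically closed field and $q$ a prime number different from the characteristic of $k$. Let $f$ and $g$ be nonzero irreducible power series in $k[[x,y]]$. If $f$ is a $q$th power modulo $g$, then the residue class of $g$ is a $q$th power in the normalization of $k[[x,y]]/(f)$. There exist functions $s$, $t$ in $k((x,y))$ satisfying $g - s^q = ft$.
   Context: "$f$ is a $q$th power modulo $g$" means there is $h\in k[[x,y]]$ with $f-h^q\in g\,k[[x,y]]$. The normalization of the domain $k[[x,y]]/(f)$ is its integral closure in its field of fractions. $k((x,y))$ denotes the field of fractions of $k[[x,y]]$. The final sentence of the claim is asserted under the same hypothesis that $f$ is a $q$th power modulo $g$. *)

theory Defs
  imports
    "HOL-Algebra.Algebraic_Closure_Type"
    "HOL-Algebra.QuotRing"
    "HOL-Algebra.Polynomials"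
    "HOL-Computational_Algebra.Computational_Algebra"
begin

(* k[[x,y]], realised as k[[x]][[y]]. *)
type_synonym 'k fps2 = "'k fps fps"

definition power_mod :: "nat \<Rightarrow> 'r::comm_ring_1 \<Rightarrow> 'r \<Rightarrow> bool" where
  "power_mod q f g \<longleftrightarrow> (\<exists>h. g dvd f - h ^ q)"

(* The fraction field of a domain R given as a record. The pair (a, b) stands for a/b. *)

definition fraction_rel :: "('a, 'm) ring_scheme \<Rightarrow> (('a \<times> 'a) \<times> ('a \<times> 'a)) set" where
  "fraction_rel R =
     {((a, b), (c, d)). a \<in> carrier R \<and> b \<in> carrier R - {\<zero>\<^bsub>R\<^esub>} \<and>
                        c \<in> carrier R \<and> d \<in> carrier R - {\<zero>\<^bsub>R\<^esub>} \<and>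
                        a \<otimes>\<^bsub>R\<^esub> d = c \<otimes>\<^bsub>R\<^esub> b}"

definition fraction :: "('a, 'm) ring_scheme \<Rightarrow> 'a \<Rightarrow> 'a \<Rightarrow> ('a \<times> 'a) set" where
  "fraction R a b = fraction_rel R `` {(a, b)}"

definition fraction_field :: "('a, 'm) ring_scheme \<Rightarrow> ('a \<times> 'a) set ring" where
  "fraction_field R =
     \<lparr>carrier = (carrier R \<times> (carrier R - {\<zero>\<^bsub>R\<^esub>})) // fraction_rel R,
      monoid.mult = (\<lambda>u v. \<Union>(a, b)\<in>u. \<Union>(c, d)\<in>v. fraction R (a \<otimes>\<^bsub>R\<^esub> c) (b \<otimes>\<^bsub>R\<^esub> d)),
      monoid.one = fraction R \<one>\<^bsub>R\<^esub> \<one>\<^bsub>R\<^esub>,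
      ring.zero = fraction R \<zero>\<^bsub>R\<^esub> \<one>\<^bsub>R\<^esub>,
      ring.add = (\<lambda>u v. \<Union>(a, b)\<in>u. \<Union>(c, d)\<in>v.
               fraction R (a \<otimes>\<^bsub>R\<^esub> d \<oplus>\<^bsub>R\<^esub> c \<otimes>\<^bsub>R\<^esub> b) (b \<otimes>\<^bsub>R\<^esub> d))\<rparr>"

definition fraction_embed :: "('a, 'm) ring_scheme \<Rightarrow> 'a \<Rightarrow> ('a \<times> 'a) set" where
  "fraction_embed R a = fraction R a \<one>\<^bsub>R\<^esub>"

(* In theory Polynomials a polynomial is its coefficient list, leading coefficient first;
   hence the witness p is a monic polynomial with coefficients in A and root z. *)
definition integral_over :: "('a, 'm) ring_scheme \<Rightarrow> 'a set \<Rightarrow> 'a \<Rightarrow> bool" where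
  "integral_over K A z \<longleftrightarrow>
     (\<exists>p. polynomial\<^bsub>K\<^esub> A p \<and> p \<noteq> [] \<and> hd p = \<one>\<^bsub>K\<^esub> \<and> ring.eval K p z = \<zero>\<^bsub>K\<^esub>)"

definition normalization :: "('a, 'm) ring_scheme \<Rightarrow> ('a \<times> 'a) set ring" where
  "normalization R = (fraction_field R)
     \<lparr>carrier := {z \<in> carrier (fraction_field R).
                   integral_over (fraction_field R) (fraction_embed R ` carrier R) z}\<rparr>"

definition fps2_ideal :: "'k::field fps2 \<Rightarrow> 'k fps2 set" where
  "fps2_ideal f = PIdl\<^bsub>ring_of_type_algebra\<^esub> f"

definition fps2_quotient :: "'k::field fps2 \<Rightarrow> 'k fps2 set ring" where
  "fps2_quotient f = ring_of_type_algebra Quot fps2_ideal f"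

definition residue_class :: "'k::field fps2 \<Rightarrow> 'k fps2 \<Rightarrow> 'k fps2 set" where
  "residue_class f g = fps2_ideal f +>\<^bsub>ring_of_type_algebra\<^esub> g"


lemma UN_UN_const:
  assumes "\<And>a b c d. (a, b) \<in> U \<Longrightarrow> (c, d) \<in> V \<Longrightarrow> F a b c d = Z" "p \<in> U" "r \<in> V"
  shows "(\<Union>(a, b)\<in>U. \<Union>(c, d)\<in>V. F a b c d) = Z"
proof (intro equalityI subsetI)
  fix z assume "z \<in> (\<Union>(a, b)\<in>U. \<Union>(c, d)\<in>V. F a b c d)"
  then obtain a b c d where "(a, b) \<in> U" "(c, d) \<in> V" "z \<in> F a b c d"
    by blast
  with assms(1)[of a b c d] show "z \<in> Z" by simp
next
  fix z assume "z \<in> Z"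
  obtain a b c d where p: "p = (a, b)" and r: "r = (c, d)"
    by (cases p, cases r)
  have "z \<in> F a b c d"
    using assms(1)[of a b c d] assms(2,3) \<open>z \<in> Z\<close> unfolding p r by simp
  then show "z \<in> (\<Union>(a, b)\<in>U. \<Union>(c, d)\<in>V. F a b c d)"
    using assms(2,3) unfolding p r by blast
qed

lemma (in domain) fraction_rel_equiv:
  "equiv (carrier R \<times> (carrier R - {\<zero>})) (fraction_rel R)"
proof (rule equivI)
  show "fraction_rel R \<subseteq> (carrier R \<times> (carrier R - {\<zero>})) \<times> carrier R \<times> (carrier R - {\<zero>})"
    by (auto simp: fraction_rel_def)
  show "refl_on (carrier R \<times> (carrier R - {\<zero>})) (fraction_rel R)"
    by (auto simp: fraction_rel_def refl_on_def)
  show "sym (fraction_rel R)"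
    by (auto simp: fraction_rel_def sym_def)
  show "trans (fraction_rel R)"
  proof (rule transI, clarify)
    fix a b c d e h
    assume "((a, b), (c, d)) \<in> fraction_rel R" "((c, d), (e, h)) \<in> fraction_rel R"
    then have car: "a \<in> carrier R" "b \<in> carrier R" "c \<in> carrier R" "d \<in> carrier R"
        "e \<in> carrier R" "h \<in> carrier R" and nz: "b \<noteq> \<zero>" "d \<noteq> \<zero>" "h \<noteq> \<zero>"
      and 1: "a \<otimes> d = c \<otimes> b" and 2: "c \<otimes> h = e \<otimes> d"
      by (auto simp: fraction_rel_def)
    have "d \<otimes> (a \<otimes> h) = (a \<otimes> d) \<otimes> h" using car by (simp add: m_ac)
    also have "\<dots> = (c \<otimes> h) \<otimes> b" using car 1 by (simp add: m_ac)
    also have "\<dots> = d \<otimes> (e \<otimes> b)" using car 2 by (simp add: m_ac)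
    finally have "a \<otimes> h = e \<otimes> b" using car nz m_lcancel by auto
    then show "((a, b), (e, h)) \<in> fraction_rel R"
      using car nz by (auto simp: fraction_rel_def)
  qed
qed

lemma (in domain) fraction_eq_iff:
  assumes "a \<in> carrier R" "b \<in> carrier R - {\<zero>}" "c \<in> carrier R" "d \<in> carrier R - {\<zero>}"
  shows "fraction R a b = fraction R c d \<longleftrightarrow> a \<otimes> d = c \<otimes> b"
  unfolding fraction_def
  using eq_equiv_class_iff[OF fraction_rel_equiv, of "(a, b)" "(c, d)"] assms
  by (auto simp: fraction_rel_def)

lemma (in domain) carrier_fraction_field:
  "carrier (fraction_field R) = {fraction R a b | a b. a \<in> carrier R \<and> b \<in> carrier R - {\<zero>}}"
  by (auto simp: fraction_field_def fraction_def quotient_def)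

lemma (in domain) mem_fraction:
  assumes "a \<in> carrier R" "b \<in> carrier R - {\<zero>}"
  shows "(c, d) \<in> fraction R a b \<longleftrightarrow>
           c \<in> carrier R \<and> d \<in> carrier R - {\<zero>} \<and> fraction R c d = fraction R a b"
  using assms fraction_eq_iff[of a b c d] by (auto simp: fraction_def fraction_rel_def)

lemma (in domain) fraction_self:
  assumes "a \<in> carrier R" "b \<in> carrier R - {\<zero>}"
  shows "(a, b) \<in> fraction R a b"
  using assms by (simp add: mem_fraction)

lemma (in domain) fraction_mult:
  assumes "a \<in> carrier R" "b \<in> carrier R - {\<zero>}" "c \<in> carrier R" "d \<in> carrier R - {\<zero>}"
  shows "fraction R a b \<otimes>\<^bsub>fraction_field R\<^esub> fraction R c d = fraction R (a \<otimes> c) (b \<otimes> d)"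
proof -
  have key: "fraction R (a' \<otimes> c') (b' \<otimes> d') = fraction R (a \<otimes> c) (b \<otimes> d)"
    if ab: "(a', b') \<in> fraction R a b" and cd: "(c', d') \<in> fraction R c d" for a' b' c' d'
  proof -
    have car: "a' \<in> carrier R" "b' \<in> carrier R - {\<zero>}" "c' \<in> carrier R" "d' \<in> carrier R - {\<zero>}"
      and 1: "a' \<otimes> b = a \<otimes> b'" and 2: "c' \<otimes> d = c \<otimes> d'"
      using ab cd assms by (auto simp: mem_fraction fraction_eq_iff)
    have "(a' \<otimes> c') \<otimes> (b \<otimes> d) = (a' \<otimes> b) \<otimes> (c' \<otimes> d)"
      using car assms by (simp add: m_ac)
    also have "\<dots> = (a \<otimes> c) \<otimes> (b' \<otimes> d')"
      using car assms unfolding 1 2 by (simp add: m_ac)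
    finally show ?thesis
      using car assms integral by (subst fraction_eq_iff) auto
  qed
  show ?thesis
    unfolding fraction_field_def monoid.simps ring.simps
    by (rule UN_UN_const[OF _ fraction_self[OF assms(1,2)] fraction_self[OF assms(3,4)]])
       (rule key)
qed

lemma (in domain) fraction_add:
  assumes "a \<in> carrier R" "b \<in> carrier R - {\<zero>}" "c \<in> carrier R" "d \<in> carrier R - {\<zero>}"
  shows "fraction R a b \<oplus>\<^bsub>fraction_field R\<^esub> fraction R c d
           = fraction R (a \<otimes> d \<oplus> c \<otimes> b) (b \<otimes> d)"
proof -
  have key: "fraction R (a' \<otimes> d' \<oplus> c' \<otimes> b') (b' \<otimes> d') = fraction R (a \<otimes> d \<oplus> c \<otimes> b) (b \<otimes> d)"
    if ab: "(a', b') \<in> fraction R a b" and cd: "(c', d') \<in> fraction R c d" for a' b' c' d'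
  proof -
    have car: "a' \<in> carrier R" "b' \<in> carrier R - {\<zero>}" "c' \<in> carrier R" "d' \<in> carrier R - {\<zero>}"
      and 1: "a' \<otimes> b = a \<otimes> b'" and 2: "c' \<otimes> d = c \<otimes> d'"
      using ab cd assms by (auto simp: mem_fraction fraction_eq_iff)
    have "(a' \<otimes> d' \<oplus> c' \<otimes> b') \<otimes> (b \<otimes> d) = (a' \<otimes> b) \<otimes> (d \<otimes> d') \<oplus> (c' \<otimes> d) \<otimes> (b \<otimes> b')"
      using car assms by (simp add: l_distr r_distr m_ac)
    also have "\<dots> = (a \<otimes> d \<oplus> c \<otimes> b) \<otimes> (b' \<otimes> d')"
      using car assms unfolding 1 2 by (simp add: l_distr r_distr m_ac)
    finally show ?thesis
      using car assms integral by (subst fraction_eq_iff) auto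
  qed
  show ?thesis
    unfolding fraction_field_def monoid.simps ring.simps
    by (rule UN_UN_const[OF _ fraction_self[OF assms(1,2)] fraction_self[OF assms(3,4)]])
       (rule key)
qed

lemma (in domain) fraction_closed:
  assumes "a \<in> carrier R" "b \<in> carrier R - {\<zero>}"
  shows "fraction R a b \<in> carrier (fraction_field R)"
  using assms unfolding carrier_fraction_field by blast

lemma (in domain) fraction_cases:
  assumes "x \<in> carrier (fraction_field R)"
  obtains a b where "x = fraction R a b" "a \<in> carrier R" "b \<in> carrier R - {\<zero>}"
  using assms unfolding carrier_fraction_field by blast

lemma (in domain) field_fraction_field: "field (fraction_field R)"
proof -
  let ?K = "fraction_field R"
  have one: "\<one>\<^bsub>?K\<^esub> = fraction R \<one> \<one>" and zero: "\<zero>\<^bsub>?K\<^esub> = fraction R \<zero> \<one>"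
    by (simp_all add: fraction_field_def)
  have nz: "b \<otimes> d \<noteq> \<zero>" if "b \<in> carrier R" "d \<in> carrier R" "b \<noteq> \<zero>" "d \<noteq> \<zero>" for b d
    using that integral by blast
  note ops = one zero fraction_mult fraction_add nz fraction_closed
  have "cring ?K"
  proof (rule cringI)
    show "abelian_group ?K"
    proof (rule abelian_groupI)
      fix x y assume "x \<in> carrier ?K" "y \<in> carrier ?K"
      then show "x \<oplus>\<^bsub>?K\<^esub> y \<in> carrier ?K"
        by (elim fraction_cases) (simp add: ops)
    next
      show "\<zero>\<^bsub>?K\<^esub> \<in> carrier ?K" by (simp add: ops)
    next
      fix x y z assume "x \<in> carrier ?K" "y \<in> carrier ?K" "z \<in> carrier ?K"
      then show "x \<oplus>\<^bsub>?K\<^esub> y \<oplus>\<^bsub>?K\<^esub> z = x \<oplus>\<^bsub>?K\<^esub> (y \<oplus>\<^bsub>?K\<^esub> z)"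
        by (elim fraction_cases) (simp add: ops l_distr r_distr m_ac a_ac)
    next
      fix x y assume "x \<in> carrier ?K" "y \<in> carrier ?K"
      then show "x \<oplus>\<^bsub>?K\<^esub> y = y \<oplus>\<^bsub>?K\<^esub> x"
        by (elim fraction_cases) (simp add: ops m_ac a_ac)
    next
      fix x assume "x \<in> carrier ?K"
      then show "\<zero>\<^bsub>?K\<^esub> \<oplus>\<^bsub>?K\<^esub> x = x"
        by (elim fraction_cases) (simp add: ops)
    next
      fix x assume "x \<in> carrier ?K"
      then obtain a b where x: "x = fraction R a b" and ab: "a \<in> carrier R" "b \<in> carrier R - {\<zero>}"
        by (elim fraction_cases)
      have "fraction R (\<ominus> a) b \<oplus>\<^bsub>?K\<^esub> x = \<zero>\<^bsub>?K\<^esub>"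
        unfolding x one zero using ab nz[of b b]
        by (subst fraction_add) (auto simp: fraction_eq_iff l_minus l_neg)
      then show "\<exists>y\<in>carrier ?K. y \<oplus>\<^bsub>?K\<^esub> x = \<zero>\<^bsub>?K\<^esub>"
        using ab fraction_closed[of "\<ominus> a" b] by blast
    qed
    show "comm_monoid ?K"
    proof (rule comm_monoidI)
      fix x y assume "x \<in> carrier ?K" "y \<in> carrier ?K"
      then show "x \<otimes>\<^bsub>?K\<^esub> y \<in> carrier ?K"
        by (elim fraction_cases) (simp add: ops)
    next
      show "\<one>\<^bsub>?K\<^esub> \<in> carrier ?K" by (simp add: ops)
    next
      fix x y z assume "x \<in> carrier ?K" "y \<in> carrier ?K" "z \<in> carrier ?K"
      then show "x \<otimes>\<^bsub>?K\<^esub> y \<otimes>\<^bsub>?K\<^esub> z = x \<otimes>\<^bsub>?K\<^esub> (y \<otimes>\<^bsub>?K\<^esub> z)"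
        by (elim fraction_cases) (simp add: ops m_ac)
    next
      fix x assume "x \<in> carrier ?K"
      then show "\<one>\<^bsub>?K\<^esub> \<otimes>\<^bsub>?K\<^esub> x = x"
        by (elim fraction_cases) (simp add: ops)
    next
      fix x y assume "x \<in> carrier ?K" "y \<in> carrier ?K"
      then show "x \<otimes>\<^bsub>?K\<^esub> y = y \<otimes>\<^bsub>?K\<^esub> x"
        by (elim fraction_cases) (simp add: ops m_ac)
    qed
  next
    fix x y z assume "x \<in> carrier ?K" "y \<in> carrier ?K" "z \<in> carrier ?K"
    then show "(x \<oplus>\<^bsub>?K\<^esub> y) \<otimes>\<^bsub>?K\<^esub> z = x \<otimes>\<^bsub>?K\<^esub> z \<oplus>\<^bsub>?K\<^esub> y \<otimes>\<^bsub>?K\<^esub> z"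
      by (elim fraction_cases) (simp add: ops fraction_eq_iff l_distr r_distr m_ac)
  qed
  then interpret K: cring ?K .
  show ?thesis
  proof (rule K.cring_fieldI2)
    show "\<zero>\<^bsub>?K\<^esub> \<noteq> \<one>\<^bsub>?K\<^esub>"
      unfolding one zero by (subst fraction_eq_iff) auto
  next
    fix x assume xK: "x \<in> carrier ?K" and "x \<noteq> \<zero>\<^bsub>?K\<^esub>"
    from xK obtain a b where x: "x = fraction R a b" and a: "a \<in> carrier R"
      and b: "b \<in> carrier R - {\<zero>}"
      by (elim fraction_cases)
    have "a \<noteq> \<zero>"
      using \<open>x \<noteq> \<zero>\<^bsub>?K\<^esub>\<close> a b unfolding x zero by (subst (asm) fraction_eq_iff) auto
    have "x \<otimes>\<^bsub>?K\<^esub> fraction R b a = \<one>\<^bsub>?K\<^esub>"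
      unfolding x one using a b \<open>a \<noteq> \<zero>\<close>
      by (subst fraction_mult, simp_all, subst fraction_eq_iff) (auto simp: m_comm nz)
    then show "\<exists>y\<in>carrier ?K. x \<otimes>\<^bsub>?K\<^esub> y = \<one>\<^bsub>?K\<^esub>"
      using a b \<open>a \<noteq> \<zero>\<close> fraction_closed[of b a] by blast
  qed
qed

lemma (in domain) fraction_embed_ring_hom:
  "fraction_embed R \<in> ring_hom R (fraction_field R)"
proof (rule ring_hom_memI)
  show "fraction_embed R \<one> = \<one>\<^bsub>fraction_field R\<^esub>"
    by (simp add: fraction_embed_def fraction_field_def)
qed (simp_all add: fraction_embed_def fraction_mult fraction_add fraction_closed)

lemma (in domain) inj_on_fraction_embed: "inj_on (fraction_embed R) (carrier R)"
  by (auto simp: inj_on_def fraction_embed_def fraction_eq_iff)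

end

theory Submission
  imports Defs "HOL-Library.Extended_Nat"
begin

text \<open>
  Write S = k[[x,y]]. The normalization of S/(f) is a discrete valuation ring O whose residue field
  is k, because k is algebraically closed; let w be its valuation. For every g prime to f the value
  w(g) equals the colength dim S/(f,g): multiplication by g shifts values by w(g), and S/(f) has
  finite codimension in O. The colength is symmetric in f and g. So if v denotes the valuation
  attached to g and f is congruent to h^q modulo g, then
  w(g) = dim S/(f,g) = v(f) = v(h^q) = q v(h) is divisible by q. In a complete discrete valuation
  ring whose residue field is algebraically closed of characteristic different from q, an element
  whose value is divisible by q is a qth power. This gives a root of g in the fraction field of
  S/(f), and a root of X^q - g is integral over S/(f).

  The argument is arranged so that O itself never appears. The locale \<open>branch_valuation\<close> lists what is
  needed of the function w on S: it is a valuation that is infinite exactly on (f), its residue field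
  is k, and for some number C every value from C on is attained, and an element whose value exceeds
  that of a by at least C is a multiple of a modulo f (C is a conductor exponent). Its existence is \<open>irreducible_has_branch_valuation\<close>. A
  maximal subring argument (\<open>valuation_ring_exists\<close>) supplies a valuation ring dominating S/(f);
  Weierstrass division shows that the function field of the branch has finite degree over k((x)),
  which bounds the number of values below that of x (\<open>no_descending_chain\<close>) and makes the residue
  field algebraic over k (\<open>residue_field\<close>). Hence there is a uniformizer p, and the powers of p below
  the ramification index generate the valuation ring over k[[x]] (\<open>integral_basis\<close>); this is the
  finiteness behind the conductor.

  The equality of w(g) with the colength is \<open>valuation_eq_colength\<close>: elements of S whose values run
  through the values of S that are not values of multiples of g form a basis of S/(f,g).
  The root is extracted in \<open>root_exists\<close> by successive approximation inside S, after multiplying g by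
  the qth power of an element of conductor value.
\<close>

section \<open>Linear systems over a domain\<close>

text \<open>
  Elimination without division: with a pivot \<open>m p j\<close>, every other row is replaced by its combination
  with row \<open>p\<close> that vanishes in column \<open>j\<close>. The domain will be \<open>k\<close>, where this makes colengths well
  defined, and \<open>k[[x]]\<close>, where it bounds the degree of the function field of a branch.
\<close>
lemma homogeneous_system_nontrivial:
  fixes m :: "'i \<Rightarrow> 'j \<Rightarrow> 'a::idom"
  assumes "finite B" "finite A" "card B < card A"
  shows "\<exists>c. (\<exists>i\<in>A. c i \<noteq> 0) \<and> (\<forall>j\<in>B. (\<Sum>i\<in>A. c i * m i j) = 0)"
  using assms
proof (induction B arbitrary: A m rule: finite_induct)
  case empty
  then obtain i where "i \<in> A" by fastforce
  then show ?case by (intro exI[of _ "\<lambda>_. 1"]) auto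
next
  case (insert j B)
  show ?case
  proof (cases "\<forall>i\<in>A. m i j = 0")
    case True
    obtain c where "\<exists>i\<in>A. c i \<noteq> 0" "\<forall>j\<in>B. (\<Sum>i\<in>A. c i * m i j) = 0"
      using insert.IH[of A m] insert.prems insert.hyps by auto
    with True show ?thesis by (intro exI[of _ c]) auto
  next
    case False
    then obtain p where p: "p \<in> A" "m p j \<noteq> 0" by blast
    have "card B < card (A - {p})"
      using insert.prems insert.hyps p by (simp add: card_Diff_singleton)
    then obtain c where c: "\<exists>i\<in>A - {p}. c i \<noteq> 0"
        "\<forall>j'\<in>B. (\<Sum>i\<in>A - {p}. c i * (m p j * m i j' - m i j * m p j')) = 0"
      using insert.IH[of "A - {p}" "\<lambda>i j'. m p j * m i j' - m i j * m p j'"] insert.prems by auto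
    define C where "C = (\<lambda>i. if i = p then - (\<Sum>i\<in>A - {p}. c i * m i j) else m p j * c i)"
    have split: "(\<Sum>i\<in>A. C i * m i j') =
        (\<Sum>i\<in>A - {p}. c i * (m p j * m i j' - m i j * m p j'))" for j'
    proof -
      have "(\<Sum>i\<in>A. C i * m i j') = C p * m p j' + (\<Sum>i\<in>A - {p}. C i * m i j')"
        using insert.prems p by (simp add: sum.remove)
      also have "(\<Sum>i\<in>A - {p}. C i * m i j') = (\<Sum>i\<in>A - {p}. c i * m p j * m i j')"
        by (intro sum.cong) (auto simp: C_def)
      also have "C p * m p j' = (\<Sum>i\<in>A - {p}. - (c i * m i j * m p j'))"
        by (simp add: C_def sum_distrib_right sum_negf)
      finally show ?thesis
        by (simp only: sum.distrib[symmetric]) (intro sum.cong refl, simp add: algebra_simps)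
    qed
    show ?thesis
    proof (intro exI[of _ C] conjI ballI)
      show "\<exists>i\<in>A. C i \<noteq> 0" using c(1) p by (auto simp: C_def)
    next
      fix j' assume j': "j' \<in> insert j B"
      show "(\<Sum>i\<in>A. C i * m i j') = 0"
      proof (cases "j' = j")
        case True
        have "(\<Sum>i\<in>A. C i * m i j) = (\<Sum>i\<in>A - {p}. 0)"
          unfolding split by (intro sum.cong refl) (simp add: mult.commute)
        with True show ?thesis by simp
      next
        case False
        with j' have "j' \<in> B" by simp
        then show ?thesis unfolding split by (rule c(2)[rule_format])
      qed
    qed
  qed
qed

section \<open>Power series in two variables and Weierstrass division\<close>

definition xvar :: "'k::field fps2" where "xvar = fps_const fps_X"
abbreviation yvar :: "'k::field fps2" where "yvar \<equiv> fps_X"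
definition scalar :: "'k::field \<Rightarrow> 'k fps2" where "scalar c = fps_const (fps_const c)"

lemma xvar_nonzero [simp]: "xvar \<noteq> (0 :: 'k::field fps2)"
  by (simp add: xvar_def)

lemma xvar_power: "xvar ^ n = fps_const (fps_X ^ n)"
  by (simp add: xvar_def)

lemma xvar_power_mult_nth: "(xvar ^ n * a) $ i = fps_X ^ n * a $ i"
  by (simp add: xvar_power)

lemma xvar_mult_nth: "(xvar * a) $ i = fps_X * a $ i"
  by (simp add: xvar_def)

lemma scalar_add: "scalar (a + b) = scalar a + scalar b"
  and scalar_mult: "scalar (a * b) = scalar a * scalar b"
  and scalar_uminus: "scalar (- a) = - scalar a"
  and scalar_diff: "scalar (a - b) = scalar a - scalar b"
  and scalar_0 [simp]: "scalar 0 = 0"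
  and scalar_1 [simp]: "scalar 1 = 1"
  by (simp_all add: scalar_def)

lemma scalar_sum: "scalar (sum h I) = (\<Sum>i\<in>I. scalar (h i))"
  by (induction I rule: infinite_finite_induct) (simp_all add: scalar_add)

lemma scalar_power: "scalar (a ^ n) = scalar a ^ n"
  by (induction n) (simp_all add: scalar_mult)

lemma fps_X_power_dvd_iff:
  fixes a :: "'a::comm_ring_1 fps"
  shows "fps_X ^ n dvd a \<longleftrightarrow> (\<forall>i<n. a $ i = 0)"
proof
  assume "fps_X ^ n dvd a"
  then obtain b where "a = fps_X ^ n * b" by blast
  then show "\<forall>i<n. a $ i = 0" by (simp add: fps_X_power_mult_nth)
next
  assume "\<forall>i<n. a $ i = 0"
  then have "a = fps_X ^ n * fps_shift n a"
    by (simp add: fps_eq_iff fps_X_power_mult_nth)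
  then show "fps_X ^ n dvd a" by (rule dvdI)
qed

lemma fps_const_dvd_iff:
  fixes c :: "'a::comm_ring_1"
  shows "fps_const c dvd a \<longleftrightarrow> (\<forall>i. c dvd a $ i)"
proof
  assume "\<forall>i. c dvd a $ i"
  then have "\<forall>i. \<exists>b. a $ i = c * b" by (simp add: dvd_def)
  then obtain b where "\<forall>i. a $ i = c * b i" by metis
  then have "a = fps_const c * Abs_fps b" by (simp add: fps_eq_iff)
  then show "fps_const c dvd a" by (rule dvdI)
next
  assume "fps_const c dvd a"
  then show "\<forall>i. c dvd a $ i" by (auto simp: dvd_def)
qed

lemma xvar_power_dvd_iff:
  "xvar ^ n dvd a \<longleftrightarrow> (\<forall>j. \<forall>i<n. a $ j $ i = 0)"
  unfolding xvar_power fps_const_dvd_iff fps_X_power_dvd_iff ..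

text \<open>
  Completeness along the powers of a single element: a series with general term \<open>t ^ i * d i\<close> has a
  limit. Both \<open>x\<close> and \<open>y\<close> are needed in this role, because either may vanish on a given branch.
\<close>
definition adically_complete :: "'a::comm_ring_1 \<Rightarrow> bool" where
  "adically_complete t \<longleftrightarrow> (\<forall>d. \<exists>s. \<forall>n. t ^ n dvd s - (\<Sum>i<n. t ^ i * d i))"

lemma fps_X_adic_limit:
  fixes d :: "nat \<Rightarrow> 'a::comm_ring_1 fps"
  shows "fps_X ^ n dvd Abs_fps (\<lambda>m. \<Sum>i\<le>m. d i $ (m - i)) - (\<Sum>i<n. fps_X ^ i * d i)"
  unfolding fps_X_power_dvd_iff
proof (intro allI impI)
  fix m assume m: "m < n"
  have "(\<Sum>i<n. fps_X ^ i * d i) $ m = (\<Sum>i<n. if m < i then 0 else d i $ (m - i))"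
    by (simp only: fps_sum_nth fps_X_power_mult_nth)
  also have "\<dots> = (\<Sum>i\<le>m. if m < i then 0 else d i $ (m - i))"
    using m by (intro sum.mono_neutral_right) auto
  also have "\<dots> = (\<Sum>i\<le>m. d i $ (m - i))"
    by (intro sum.cong) auto
  finally show "(Abs_fps (\<lambda>m. \<Sum>i\<le>m. d i $ (m - i)) - (\<Sum>i<n. fps_X ^ i * d i)) $ m = 0"
    by (simp only: fps_sub_nth fps_nth_Abs_fps diff_self)
qed

lemma adically_complete_yvar: "adically_complete (yvar :: 'k::field fps2)"
  unfolding adically_complete_def by (intro allI exI) (rule fps_X_adic_limit)

lemma adically_complete_xvar: "adically_complete (xvar :: 'k::field fps2)"
  unfolding adically_complete_def
proof
  fix d :: "nat \<Rightarrow> 'k fps2"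
  let ?s = "Abs_fps (\<lambda>j. Abs_fps (\<lambda>m. \<Sum>i\<le>m. d i $ j $ (m - i)))"
  have "xvar ^ n dvd ?s - (\<Sum>i<n. xvar ^ i * d i)" for n
    unfolding xvar_power[of n] fps_const_dvd_iff
  proof
    fix j
    have "(?s - (\<Sum>i<n. xvar ^ i * d i)) $ j =
        Abs_fps (\<lambda>m. \<Sum>i\<le>m. d i $ j $ (m - i)) - (\<Sum>i<n. fps_X ^ i * d i $ j)"
      by (simp only: fps_sub_nth fps_sum_nth xvar_power_mult_nth fps_nth_Abs_fps)
    then show "fps_X ^ n dvd (?s - (\<Sum>i<n. xvar ^ i * d i)) $ j"
      using fps_X_adic_limit[of n "\<lambda>i. d i $ j"] by (simp only:)
  qed
  then show "\<exists>s. \<forall>n. xvar ^ n dvd s - (\<Sum>i<n. xvar ^ i * d i)" by (intro exI allI)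
qed

lemma xvar_power_dvd_all_imp_zero:
  assumes "\<And>n. xvar ^ n dvd (a :: 'k::field fps2)" shows "a = 0"
proof -
  have "a $ j $ i = 0" for i j
    using assms[of "Suc i"] unfolding xvar_power_dvd_iff by blast
  then show ?thesis by (simp add: fps_eq_iff)
qed

lemma is_unit_fps2_iff: "(a :: 'k::field fps2) dvd 1 \<longleftrightarrow> a $ 0 $ 0 \<noteq> 0"
proof
  assume "a dvd 1"
  then obtain b where "1 = a * b" by blast
  then have "(1 :: 'k fps2) $ 0 = (a * b) $ 0" by (rule arg_cong)
  then have "1 = a $ 0 * b $ 0" by (simp only: fps_mult_nth_0 fps_one_nth if_True simp_thms refl)
  then have "a $ 0 dvd 1" by (rule dvdI)
  then show "a $ 0 $ 0 \<noteq> 0" by simp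
next
  assume "a $ 0 $ 0 \<noteq> 0"
  then have "a $ 0 * inverse (a $ 0) = 1" by (metis inverse_mult_eq_1')
  then have "1 = a * fps_right_inverse a (inverse (a $ 0))"
    using fps_right_inverse[of a "inverse (a $ 0)"] by simp
  then show "a dvd 1" by (rule dvdI)
qed

lemma scalar_dvd_1: "c \<noteq> 0 \<Longrightarrow> scalar c dvd 1"
  by (simp add: is_unit_fps2_iff scalar_def)

lemma fps_const_split: "fps_const (fps_shift n c) = scalar (c $ n) + xvar * fps_const (fps_shift (Suc n) c)"
  for c :: "'k::field fps"
proof -
  have "fps_shift n c = fps_const (c $ n) + fps_X * fps_shift (Suc n) c"
  proof (rule fps_ext)
    fix j show "fps_shift n c $ j = (fps_const (c $ n) + fps_X * fps_shift (Suc n) c) $ j"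
      by (cases j) simp_all
  qed
  then show ?thesis by (simp add: scalar_def xvar_def)
qed

text \<open>
  Let \<open>\<tau>\<close> forget the coefficients of \<open>y ^ i\<close> for \<open>i < n\<close> and divide by \<open>y ^ n\<close>. Since
  \<open>F = x A + y ^ n U\<close> with \<open>U\<close> a unit with inverse \<open>V\<close>, the required condition \<open>\<tau> (F u) = \<tau> g\<close> reads
  \<open>z = \<tau> g - x \<tau> (A V z)\<close> in the unknown \<open>z = U u\<close>. The right-hand side is a contraction for
  the x-adic topology, and the fixed point is the sum of the iterates \<open>x ^ i * d i\<close>.
\<close>
lemma weierstrass_division:
  fixes F g :: "'k::field fps2"
  assumes low: "\<And>i. i < n \<Longrightarrow> F $ i $ 0 = 0" and unit: "F $ n $ 0 \<noteq> 0"
  shows "\<exists>u. \<forall>i\<ge>n. (g - F * u) $ i = 0"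
proof -
  define U where "U = fps_shift n F"
  have "U dvd 1" unfolding is_unit_fps2_iff U_def using unit by simp
  then obtain V where V: "U * V = 1" by (metis dvdE)
  have "\<forall>i<n. \<exists>b. F $ i = fps_X * b"
  proof (intro allI impI)
    fix i assume "i < n"
    then have "fps_X ^ 1 dvd F $ i" unfolding fps_X_power_dvd_iff using low by simp
    then show "\<exists>b. F $ i = fps_X * b" by (simp add: dvd_def)
  qed
  then obtain b where b: "\<And>i. i < n \<Longrightarrow> F $ i = fps_X * b i" by metis
  define A where "A = Abs_fps (\<lambda>i. if i < n then b i else 0)"
  have F: "F = xvar * A + yvar ^ n * U"
    by (rule fps_ext) (simp only: fps_add_nth xvar_mult_nth fps_X_power_mult_nth A_def U_def
      fps_nth_Abs_fps fps_shift_nth, simp add: b)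
  define \<tau> :: "'k fps2 \<Rightarrow> 'k fps2" where "\<tau> = fps_shift n"
  have \<tau>_add: "\<tau> (a + c) = \<tau> a + \<tau> c" and \<tau>_diff: "\<tau> (a - c) = \<tau> a - \<tau> c"
    and \<tau>_x: "\<tau> (xvar * a) = xvar * \<tau> a" for a c
    by (simp_all add: \<tau>_def fps_eq_iff xvar_mult_nth)
  have \<tau>_xpow: "\<tau> (xvar ^ i * a) = xvar ^ i * \<tau> a" for i a
    by (induction i) (simp_all add: \<tau>_x mult.assoc)
  have \<tau>_sum: "\<tau> (\<Sum>i<N. h i) = (\<Sum>i<N. \<tau> (h i))" for h and N :: nat
    by (induction N) (simp_all add: \<tau>_add, simp add: \<tau>_def)
  define B where "B = A * V"
  define d where "d = rec_nat (\<tau> g) (\<lambda>_ a. - \<tau> (B * a))"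
  have d0: "d 0 = \<tau> g" and dS: "d (Suc i) = - \<tau> (B * d i)" for i
    by (simp_all add: d_def)
  obtain z where z: "\<And>n. xvar ^ n dvd z - (\<Sum>i<n. xvar ^ i * d i)"
    using adically_complete_xvar unfolding adically_complete_def by blast
  have "z - \<tau> g + xvar * \<tau> (B * z) = 0"
  proof (rule xvar_power_dvd_all_imp_zero)
    fix N
    obtain e where "z - (\<Sum>i<N. xvar ^ i * d i) = xvar ^ N * e"
      using z[of N] by (rule dvdE)
    then have e: "z = (\<Sum>i<N. xvar ^ i * d i) + xvar ^ N * e"
      by (simp only: diff_eq_eq add.commute)
    have B_pow: "\<tau> (B * (xvar ^ i * a)) = xvar ^ i * \<tau> (B * a)" for i a
      using \<tau>_xpow[of i "B * a"] by (simp only: mult.left_commute)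
    have "xvar * \<tau> (B * (\<Sum>i<N. xvar ^ i * d i)) = (\<Sum>i<N. xvar * (xvar ^ i * \<tau> (B * d i)))"
      by (simp only: sum_distrib_left[of B] \<tau>_sum B_pow sum_distrib_left[of xvar])
    also have "\<dots> = (\<Sum>i<N. - (xvar ^ Suc i * d (Suc i)))"
      by (intro sum.cong refl) (simp only: dS power_Suc mult_minus_right minus_minus mult.assoc)
    also have "\<dots> = - (\<Sum>i<N. xvar ^ Suc i * d (Suc i))"
      by (rule sum_negf)
    finally have "xvar * \<tau> (B * (\<Sum>i<N. xvar ^ i * d i)) = - (\<Sum>i<N. xvar ^ Suc i * d (Suc i))" .
    moreover have "(\<Sum>i<Suc N. xvar ^ i * d i) = \<tau> g + (\<Sum>i<N. xvar ^ Suc i * d (Suc i))"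
      by (simp only: sum.lessThan_Suc_shift d0 power_0 mult_1_left)
    ultimately have 1: "(\<Sum>i<Suc N. xvar ^ i * d i) = \<tau> g - xvar * \<tau> (B * (\<Sum>i<N. xvar ^ i * d i))"
      by (simp only: diff_minus_eq_add)
    have "\<tau> (B * z) = \<tau> (B * (\<Sum>i<N. xvar ^ i * d i)) + xvar ^ N * \<tau> (B * e)"
      by (subst e, simp only: distrib_left \<tau>_add B_pow)
    moreover have "z - t + x * (p + m * e') = (z - (t - x * p)) + m * (x * e')"
      for t x p m e' :: "'k fps2" by (simp add: algebra_simps)
    ultimately have "z - \<tau> g + xvar * \<tau> (B * z)
        = (z - (\<Sum>i<Suc N. xvar ^ i * d i)) + xvar ^ N * (xvar * \<tau> (B * e))"
      by (simp only: 1)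
    moreover have "xvar ^ N dvd z - (\<Sum>i<Suc N. xvar ^ i * d i)"
      using z[of "Suc N"] by (rule power_le_dvd) simp
    ultimately show "xvar ^ N dvd z - \<tau> g + xvar * \<tau> (B * z)"
      by (simp only: dvd_add dvd_triv_left)
  qed
  moreover have "\<tau> (F * (V * z)) = xvar * \<tau> (B * z) + z"
  proof -
    have "F * (V * z) = xvar * (B * z) + yvar ^ n * ((U * V) * z)"
      by (simp add: F B_def algebra_simps)
    also have "\<tau> \<dots> = xvar * \<tau> (B * z) + z"
      unfolding V \<tau>_add \<tau>_x
      by (simp add: \<tau>_def fps_eq_iff fps_X_power_mult_nth)
    finally show ?thesis .
  qed
  ultimately have "\<tau> (g - F * (V * z)) = 0"
    unfolding \<tau>_diff by (simp add: algebra_simps)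
  then have shift: "fps_shift n (g - F * (V * z)) $ i = 0" for i
    unfolding \<tau>_def by (simp only: fps_zero_nth)
  have "(g - F * (V * z)) $ i = 0" if "n \<le> i" for i
    using shift[of "i - n"] that unfolding fps_shift_nth by (simp only: le_add_diff_inverse2)
  then show ?thesis by (intro exI[of _ "V * z"] allI impI)
qed

lemma xvar_dvd_iff: "xvar dvd (a :: 'k::field fps2) \<longleftrightarrow> (\<forall>i. a $ i $ 0 = 0)"
  using xvar_power_dvd_iff[of 1 a] by simp

lemma xvar_power_factor:
  fixes a :: "'k::field fps2"
  assumes "a \<noteq> 0"
  obtains v b where "a = xvar ^ v * b" "\<not> xvar dvd b"
proof -
  obtain j where "a $ j \<noteq> 0" using assms by (metis fps_ext fps_zero_nth)
  then obtain i where "a $ j $ i \<noteq> 0" by (metis fps_ext fps_zero_nth)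
  then have ex: "\<not> xvar ^ Suc i dvd a" unfolding xvar_power_dvd_iff by blast
  define v where "v = (LEAST i. \<not> xvar ^ Suc i dvd a)"
  have v: "\<not> xvar ^ Suc v dvd a" unfolding v_def by (rule LeastI) (rule ex)
  have "xvar ^ v dvd a"
  proof (cases v)
    case (Suc w)
    then show ?thesis using not_less_Least[of w "\<lambda>i. \<not> xvar ^ Suc i dvd a"] by (auto simp: v_def)
  qed simp
  then obtain b where b: "a = xvar ^ v * b" by blast
  have "\<not> xvar dvd b"
  proof
    assume "xvar dvd b"
    then show False using v b by (metis mult_dvd_mono dvd_refl power_Suc2)
  qed
  with b that show thesis by blast
qed

text \<open>
  The order in \<open>y\<close> of the reduction modulo \<open>x\<close>; it has no meaning for multiples of \<open>x\<close>.
\<close>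
definition weierstrass_degree :: "'k::field fps2 \<Rightarrow> nat" where
  "weierstrass_degree a = (LEAST i. a $ i $ 0 \<noteq> 0)"

lemma weierstrass_degree:
  assumes "\<not> xvar dvd (a :: 'k::field fps2)"
  shows "a $ weierstrass_degree a $ 0 \<noteq> 0" "i < weierstrass_degree a \<Longrightarrow> a $ i $ 0 = 0"
proof -
  from assms obtain j where "a $ j $ 0 \<noteq> 0" by (auto simp: xvar_dvd_iff)
  then show "a $ weierstrass_degree a $ 0 \<noteq> 0"
    unfolding weierstrass_degree_def by (rule LeastI)
next
  assume "i < weierstrass_degree a"
  then show "a $ i $ 0 = 0" unfolding weierstrass_degree_def using not_less_Least by blast
qed

text \<open>
  After inverting \<open>x\<close> the ring \<open>k[[x,y]]\<close> is Euclidean: the norm of \<open>x ^ v * c\<close>, with \<open>c\<close> prime to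
  \<open>x\<close>, is the Weierstrass degree of \<open>c\<close>, and Weierstrass division is division with remainder. Hence
  the ideal generated by \<open>a\<close> and \<open>f\<close> becomes principal, and its generator divides the irreducible
  \<open>f\<close> but is not associated to it. Equivalently, \<open>k[[x,y]]/(a,f)\<close> is killed by a power of \<open>x\<close>. This
  gives primality of irreducible elements and later bounds values of the branch valuation.
\<close>
lemma xvar_power_in_ideal_of_irreducible:
  fixes f a :: "'k::field fps2"
  assumes f: "Factorial_Ring.irreducible f" and xf: "\<not> xvar dvd f" and fa: "\<not> f dvd a"
  shows "\<exists>v \<beta> \<gamma>. xvar ^ v = \<beta> * a + \<gamma> * f"
proof -
  define J where "J = {c. \<exists>\<beta> \<gamma>. c = \<beta> * a + \<gamma> * f}"
  define D where "D = {weierstrass_degree c' | v c'. xvar ^ v * c' \<in> J \<and> \<not> xvar dvd c'}"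
  have J_ideal: "r * c - s * d \<in> J" if "c \<in> J" "d \<in> J" for r s c d
  proof -
    from that obtain p p' t t' where "c = p * a + p' * f" "d = t * a + t' * f"
      unfolding J_def by blast
    then have "r * c - s * d = (r * p - s * t) * a + (r * p' - s * t') * f"
      by (simp add: algebra_simps)
    then show ?thesis unfolding J_def by blast
  qed
  have fJ: "f \<in> J" unfolding J_def by (rule CollectI, intro exI[of _ 0] exI[of _ 1]) simp
  have aJ: "a \<in> J" unfolding J_def by (rule CollectI, intro exI[of _ 1] exI[of _ 0]) simp
  have "weierstrass_degree f \<in> D"
    unfolding D_def using fJ xf by (intro CollectI exI[of _ 0] exI[of _ f]) simp
  then have "(LEAST n. n \<in> D) \<in> D" by (rule LeastI)
  then obtain v c where c: "xvar ^ v * c \<in> J" "\<not> xvar dvd c"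
    and n: "weierstrass_degree c = (LEAST n. n \<in> D)" unfolding D_def by auto
  have dvd: "c dvd h" if h: "h \<in> J" for h
  proof -
    obtain u where u: "\<forall>i\<ge>weierstrass_degree c. (h - c * u) $ i = 0"
      using weierstrass_division[of "weierstrass_degree c" c h] weierstrass_degree[OF c(2)] by blast
    have "h - c * u = 0"
    proof (rule ccontr)
      assume "h - c * u \<noteq> 0"
      then obtain w r where r: "h - c * u = xvar ^ w * r" "\<not> xvar dvd r"
        by (rule xvar_power_factor)
      have "xvar ^ (v + w) * r = xvar ^ v * h - u * (xvar ^ v * c)"
        unfolding power_add mult.assoc r(1)[symmetric] by (simp add: algebra_simps)
      then have "xvar ^ (v + w) * r \<in> J" using J_ideal[OF h c(1)] by metis
      then have "weierstrass_degree r \<in> D" unfolding D_def using r(2) by blast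
      then have "weierstrass_degree c \<le> weierstrass_degree r"
        unfolding n by (rule Least_le)
      then have "(xvar ^ w * r) $ weierstrass_degree r = 0" using u r(1) by metis
      then have "r $ weierstrass_degree r = 0" by (simp add: xvar_power_mult_nth)
      then show False using weierstrass_degree(1)[OF r(2)] by simp
    qed
    then show ?thesis by (metis dvd_triv_left eq_iff_diff_eq_0)
  qed
  have "c dvd 1"
  proof (rule ccontr)
    assume "\<not> c dvd 1"
    moreover obtain e where e: "f = c * e" using dvd[OF fJ] by blast
    ultimately have "e dvd 1" using f unfolding Factorial_Ring.irreducible_def by blast
    then obtain e' where "1 = e * e'" by (rule dvdE)
    then have "c = f * e'" using e by (metis mult.assoc mult.right_neutral)
    then have "f dvd c" by (rule dvdI)
    then show False using dvd[OF aJ] fa dvd_trans by blast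
  qed
  then obtain c' where "1 = c * c'" by (rule dvdE)
  then have "xvar ^ v = c' * (xvar ^ v * c) - 0 * f" by (simp add: algebra_simps)
  then have "xvar ^ v \<in> J" using J_ideal[OF c(1) fJ] by metis
  then show ?thesis unfolding J_def by blast
qed

text \<open>
  The homomorphism sending \<open>s(x,y)\<close> to \<open>s(0,y)\<close>; its kernel is generated by \<open>x\<close>.
\<close>
definition at_x_zero :: "'k::field fps2 \<Rightarrow> 'k fps" where
  "at_x_zero a = Abs_fps (\<lambda>i. a $ i $ 0)"

lemma at_x_zero_add: "at_x_zero (a + b) = at_x_zero a + at_x_zero b"
  and at_x_zero_diff: "at_x_zero (a - b) = at_x_zero a - at_x_zero b"
  and at_x_zero_mult: "at_x_zero (a * b) = at_x_zero a * at_x_zero b"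
  and at_x_zero_scalar: "at_x_zero (scalar c) = fps_const c"
  by (auto simp: at_x_zero_def scalar_def fps_eq_iff fps_mult_nth fps_sum_nth)

lemma at_x_zero_eq_0_iff: "at_x_zero a = 0 \<longleftrightarrow> xvar dvd a"
  by (simp add: at_x_zero_def fps_eq_iff xvar_dvd_iff)

lemma xvar_dvd_mult_iff: "xvar dvd (a * b :: 'k::field fps2) \<longleftrightarrow> xvar dvd a \<or> xvar dvd b"
  by (simp flip: at_x_zero_eq_0_iff add: at_x_zero_mult)

lemma xvar_power_dvd_mult_left:
  assumes "\<not> xvar dvd (f :: 'k::field fps2)" "f dvd xvar ^ v * b" shows "f dvd b"
  using assms(2)
proof (induction v)
  case (Suc v)
  then obtain e where e: "xvar * (xvar ^ v * b) = f * e" by (auto simp: mult.assoc elim: dvdE)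
  then have "xvar dvd f * e" by (metis dvd_triv_left)
  then have "xvar dvd e" using assms(1) xvar_dvd_mult_iff by blast
  then obtain e' where "e = xvar * e'" by (rule dvdE)
  with e have "xvar * (xvar ^ v * b) = xvar * (f * e')" by (simp add: mult_ac)
  then have "xvar ^ v * b = f * e'" by simp
  then show ?case using Suc.IH by simp
qed simp

lemma irreducible_xvar: "Factorial_Ring.irreducible (xvar :: 'k::field fps2)"
proof (rule Factorial_Ring.irreducibleI)
  show "xvar \<noteq> (0 :: 'k fps2)" by (simp add: xvar_def)
  show "\<not> xvar dvd (1 :: 'k fps2)" by (simp add: is_unit_fps2_iff xvar_def)
  have unit: "b dvd 1" if "xvar = a * b" "xvar dvd a" for a b :: "'k fps2"
  proof -
    from that(2) obtain c where "a = xvar * c" by (rule dvdE)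
    with that(1) have "xvar * 1 = xvar * (b * c)" by (simp only: mult_ac mult_1_right mult_1_left)
    then have "1 = b * c" using \<open>xvar \<noteq> (0 :: 'k fps2)\<close> mult_left_cancel by blast
    then show "b dvd 1" by (rule dvdI)
  qed
  fix a b :: "'k fps2" assume ab: "xvar = a * b"
  have "xvar dvd a * b" unfolding ab[symmetric] by (rule dvd_refl)
  then show "a dvd 1 \<or> b dvd 1"
    using unit[of a b] unit[of b a] ab xvar_dvd_mult_iff[of a b] by (auto simp only: mult.commute)
qed

lemma irreducible_dvd_irreducible:
  fixes f g :: "'a::idom"
  assumes "Factorial_Ring.irreducible f" "Factorial_Ring.irreducible g" "f dvd g"
  shows "g dvd f"
proof -
  obtain e where e: "g = f * e" using assms(3) by blast
  then have "e dvd 1" using assms(1,2) unfolding Factorial_Ring.irreducible_def by blast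
  then obtain e' where "1 = e * e'" by (rule dvdE)
  then have "f = g * e'" using e by (metis mult.assoc mult.right_neutral)
  then show ?thesis by simp
qed

text \<open>
  If \<open>f\<close> does not divide \<open>b\<close>, some \<open>x ^ v\<close> is a combination of \<open>b\<close> and \<open>f\<close>, so \<open>f\<close> divides
  \<open>x ^ v * a\<close>, and \<open>x\<close> can be cancelled because it is prime to \<open>f\<close>.
\<close>
lemma irreducible_imp_prime_fps2:
  fixes f :: "'k::field fps2"
  assumes f: "Factorial_Ring.irreducible f" and ab: "f dvd a * b"
  shows "f dvd a \<or> f dvd b"
proof (cases "xvar dvd f")
  case True
  then have "f dvd xvar" using irreducible_dvd_irreducible[OF irreducible_xvar f] by simp
  moreover have "xvar dvd a \<or> xvar dvd b" using True ab xvar_dvd_mult_iff dvd_trans by blast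
  ultimately show ?thesis using dvd_trans by blast
next
  case False
  show ?thesis
  proof (rule disjCI)
    assume "\<not> f dvd b"
    then obtain v \<beta> \<gamma> where "xvar ^ v = \<beta> * b + \<gamma> * f"
      using xvar_power_in_ideal_of_irreducible[OF f False] by blast
    then have "xvar ^ v * a = \<beta> * (a * b) + f * (\<gamma> * a)" by (simp add: algebra_simps)
    then have "f dvd xvar ^ v * a" using ab by (metis dvd_add dvd_mult dvd_triv_left)
    then show "f dvd a" by (rule xvar_power_dvd_mult_left[OF False])
  qed
qed

section \<open>Existence of valuation rings\<close>

definition is_subring :: "'a::comm_ring_1 set \<Rightarrow> bool" where
  "is_subring A \<longleftrightarrow> 1 \<in> A \<and> (\<forall>a\<in>A. \<forall>b\<in>A. a - b \<in> A \<and> a * b \<in> A)"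

lemma is_subringD:
  assumes "is_subring A"
  shows "1 \<in> A" "0 \<in> A" "a \<in> A \<Longrightarrow> b \<in> A \<Longrightarrow> a - b \<in> A" "a \<in> A \<Longrightarrow> b \<in> A \<Longrightarrow> a * b \<in> A"
    "a \<in> A \<Longrightarrow> - a \<in> A" "a \<in> A \<Longrightarrow> b \<in> A \<Longrightarrow> a + b \<in> A" "a \<in> A \<Longrightarrow> a ^ n \<in> A"
    "(\<And>i. i \<in> I \<Longrightarrow> h i \<in> A) \<Longrightarrow> sum h I \<in> A"
proof -
  show one: "1 \<in> A" and diff: "\<And>a b. a \<in> A \<Longrightarrow> b \<in> A \<Longrightarrow> a - b \<in> A"
    and mult: "\<And>a b. a \<in> A \<Longrightarrow> b \<in> A \<Longrightarrow> a * b \<in> A"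
    using assms by (auto simp: is_subring_def)
  show zero: "0 \<in> A" using diff[OF one one] by simp
  show minus: "- a \<in> A" if "a \<in> A" for a using diff[OF zero that] by simp
  show add: "a + b \<in> A" if "a \<in> A" "b \<in> A" for a b
    using diff[OF that(1) minus[OF that(2)]] by simp
  show "a ^ n \<in> A" if "a \<in> A" for a by (induction n) (auto intro: one mult that)
  show "sum h I \<in> A" if "\<And>i. i \<in> I \<Longrightarrow> h i \<in> A" for h and I :: "'b set"
    using that by (induction I rule: infinite_finite_induct) (auto intro: zero add)
qed

text \<open>
  The subring generated by \<open>A\<close> and \<open>a\<close>, for a subring \<open>A\<close>.
\<close>
definition adjoin :: "'a::comm_ring_1 set \<Rightarrow> 'a \<Rightarrow> 'a set" where
  "adjoin A a = {poly p a | p. \<forall>i. coeff p i \<in> A}"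

lemma adjoin:
  assumes "is_subring A"
  shows "is_subring (adjoin A a)" "A \<subseteq> adjoin A a" "a \<in> adjoin A a"
proof -
  note A = is_subringD[OF assms]
  show "is_subring (adjoin A a)"
    unfolding is_subring_def
  proof (intro conjI ballI)
    show "1 \<in> adjoin A a"
      unfolding adjoin_def using A(1,2)
      by (intro CollectI exI[of _ 1]) simp
    fix b c assume "b \<in> adjoin A a" "c \<in> adjoin A a"
    then obtain p r where "b = poly p a" "c = poly r a"
        and "\<forall>i. coeff p i \<in> A" "\<forall>i. coeff r i \<in> A"
      unfolding adjoin_def by blast
    then show "b - c \<in> adjoin A a"
      unfolding adjoin_def by (intro CollectI exI[of _ "p - r"]) (simp add: A(3))
    show "b * c \<in> adjoin A a"
      unfolding adjoin_def using \<open>b = poly p a\<close> \<open>c = poly r a\<close>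
        \<open>\<forall>i. coeff p i \<in> A\<close> \<open>\<forall>i. coeff r i \<in> A\<close>
      by (intro CollectI exI[of _ "p * r"]) (simp add: coeff_mult A(4,8))
  qed
  show "A \<subseteq> adjoin A a"
  proof
    fix b assume "b \<in> A"
    then show "b \<in> adjoin A a" unfolding adjoin_def using A(2)
      by (intro CollectI exI[of _ "[:b:]"]) (auto simp: coeff_pCons split: nat.split)
  qed
  show "a \<in> adjoin A a" unfolding adjoin_def using A(1,2)
    by (intro CollectI exI[of _ "[:0, 1:]"]) (auto simp: coeff_pCons split: nat.split)
qed

text \<open>
  Chevalley's extension theorem. A subring \<open>M\<close> that is maximal among those containing \<open>A\<close> but not
  \<open>1/x\<close> is a valuation ring: if neither \<open>a\<close> nor \<open>1/a\<close> belonged to \<open>M\<close>, maximality would make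
  \<open>1/x\<close> a polynomial in \<open>a\<close> and also a polynomial in \<open>1/a\<close> over \<open>M\<close>, and the shorter of
  two shortest such expressions could be used to shorten the other.
\<close>
lemma valuation_ring_exists:
  fixes A :: "'a::field set"
  assumes A: "is_subring A" and x: "x \<in> A" "inverse x \<notin> A"
  obtains V where "is_subring V" "A \<subseteq> V" "inverse x \<notin> V" "\<And>a. a \<in> V \<or> inverse a \<in> V"
proof -
  have x0: "x \<noteq> 0" using x by auto
  define \<S> where "\<S> = {B. is_subring B \<and> A \<subseteq> B \<and> inverse x \<notin> B}"
  have "\<exists>M\<in>\<S>. \<forall>Y\<in>\<S>. M \<subseteq> Y \<longrightarrow> Y = M"
  proof (rule subset_Zorn_nonempty)
    show "\<S> \<noteq> {}" using A x unfolding \<S>_def by blast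
    fix CC assume ne: "CC \<noteq> {}" and ch: "subset.chain \<S> CC"
    then have C: "\<And>B. B \<in> CC \<Longrightarrow> is_subring B \<and> A \<subseteq> B \<and> inverse x \<notin> B"
      unfolding subset_chain_def \<S>_def by blast
    have both: "\<exists>B\<in>CC. a \<in> B \<and> b \<in> B" if ab: "a \<in> (\<Union>CC)" "b \<in> (\<Union>CC)" for a b
    proof -
      obtain B B' where B: "B \<in> CC" "a \<in> B" "B' \<in> CC" "b \<in> B'" using ab by blast
      then have "B \<subseteq> B' \<or> B' \<subseteq> B" using ch unfolding subset_chain_def by blast
      then show ?thesis using B by blast
    qed
    have "is_subring (\<Union>CC)"
      unfolding is_subring_def
    proof (intro conjI ballI)
      show "1 \<in> (\<Union>CC)" using ne C is_subringD(1) by blast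
      fix a b assume "a \<in> (\<Union>CC)" "b \<in> (\<Union>CC)"
      then obtain B where "B \<in> CC" "a \<in> B" "b \<in> B" using both by blast
      then show "a - b \<in> (\<Union>CC)" "a * b \<in> (\<Union>CC)" using C is_subringD(3,4) by blast+
    qed
    then show "(\<Union>CC) \<in> \<S>" unfolding \<S>_def using C ne by blast
  qed
  then obtain M where MS: "M \<in> \<S>" and top: "\<forall>Y\<in>\<S>. M \<subseteq> Y \<longrightarrow> Y = M" by (rule bexE)
  from MS have M: "is_subring M" "A \<subseteq> M" "inverse x \<notin> M" unfolding \<S>_def by auto
  have max: "Y = M" if "is_subring Y" "inverse x \<notin> Y" "M \<subseteq> Y" for Y
    using top that M(2) unfolding \<S>_def by auto
  note m = is_subringD[OF M(1)]
  have nz: "1 - x * b \<noteq> 0" if "b \<in> M" for b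
    using that M(3) inverse_unique[of x b] by auto
  have xM: "x \<in> M" using M(2) x(1) by blast
  have ext: "\<exists>N c. (\<forall>i. c i \<in> M) \<and> inverse x = (\<Sum>i<N. c i * a ^ i)" if "a \<notin> M" for a
  proof -
    have "inverse x \<in> adjoin M a"
      using max[OF adjoin(1)[OF M(1)], of a] adjoin(2,3)[OF M(1), of a] that by blast
    then obtain p where "inverse x = poly p a" "\<forall>i. coeff p i \<in> M"
      unfolding adjoin_def by blast
    then show ?thesis
      by (intro exI[of _ "Suc (degree p)"] exI[of _ "coeff p"]) (simp add: poly_altdef lessThan_Suc_atMost)
  qed
  \<comment> \<open>Otherwise \<open>1/x\<close> is a polynomial in \<open>1/u\<close>, where \<open>u = 1 - x b\<close>. Clearing denominators and using
    that powers of \<open>u\<close> are congruent to 1 modulo \<open>x\<close> would put \<open>1/x\<close> into \<open>M\<close>.\<close>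
  have unit: "inverse (1 - x * b) \<in> M" if b: "b \<in> M" for b
  proof (rule ccontr)
    let ?u = "1 - x * b"
    assume "inverse ?u \<notin> M"
    then obtain N c where c: "\<forall>i. c i \<in> M" "inverse x = (\<Sum>i<N. c i * inverse ?u ^ i)"
      using ext by blast
    have u0: "?u \<noteq> 0" by (rule nz) (rule b)
    have uM: "?u \<in> M" by (intro m(1,3,4) xM b)
    have "\<exists>d\<in>M. ?u ^ N = 1 - x * d"
    proof (induction N)
      case 0 then show ?case using m(2) by (intro bexI[of _ 0]) auto
    next
      case (Suc N)
      then obtain d where "d \<in> M" "?u ^ N = 1 - x * d" by blast
      then have "?u ^ Suc N = ?u * (1 - x * d)" by simp
      also have "\<dots> = 1 - x * (b + d - x * (b * d))" by (simp add: algebra_simps)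
      finally have "?u ^ Suc N = 1 - x * (b + d - x * (b * d))" .
      moreover have "b + d - x * (b * d) \<in> M" by (intro m(3,4,6) b xM \<open>d \<in> M\<close>)
      ultimately show ?case by blast
    qed
    then obtain d where d: "d \<in> M" "?u ^ N = 1 - x * d" by blast
    have "?u ^ N * inverse x = (\<Sum>i<N. c i * ?u ^ (N - i))"
      unfolding c(2) sum_distrib_left using u0
      by (intro sum.cong refl) (simp add: power_diff divide_inverse power_inverse)
    also have "\<dots> \<in> M" by (rule m(8)) (simp add: c(1) m(4,7) uM)
    finally have "?u ^ N * inverse x + d \<in> M" using d(1) m(6) by blast
    also have "?u ^ N * inverse x + d = inverse x" unfolding d(2) using x0 by (simp add: field_simps)
    finally show False using M(3) by blast
  qed
  define rep where "rep = (\<lambda>a N. \<exists>c. (\<forall>i. c i \<in> M) \<and> inverse x = (\<Sum>i<N. c i * a ^ i))"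
  have rep2: "2 \<le> N" if "rep a N" for a N
  proof (rule ccontr)
    from that obtain c where c: "\<forall>i. c i \<in> M" "inverse x = (\<Sum>i<N. c i * a ^ i)"
      unfolding rep_def by blast
    assume "\<not> 2 \<le> N"
    then have "N = 0 \<or> N = 1" by linarith
    then have "inverse x = 0 \<or> inverse x = c 0" using c(2) by auto
    then show False using c(1) M(3) m(2) by metis
  qed
  \<comment> \<open>The expression in \<open>1/a\<close> is solved for a power of \<open>a\<close>, which is possible because
    \<open>1 - x * q 0\<close> is a unit; substituting it in the top term of the expression in \<open>a\<close> lowers
    the length \<open>N\<close>.\<close>
  have core: False
    if prems: "a \<noteq> 0" "rep a N" "rep (inverse a) N'" "N' \<le> N" "\<And>K. rep a K \<Longrightarrow> N \<le> K"
    for a N N'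
  proof -
    obtain c where c: "\<And>i. c i \<in> M" "inverse x = (\<Sum>i<N. c i * a ^ i)"
      using prems(2) unfolding rep_def by blast
    obtain q where q: "\<And>i. q i \<in> M" "inverse x = (\<Sum>i<N'. q i * inverse a ^ i)"
      using prems(3) unfolding rep_def by blast
    obtain n k where n: "N = Suc n" and k: "N' = Suc k"
      using rep2[OF prems(2)] rep2[OF prems(3)] by (metis Suc_le_D numeral_2_eq_2)
    define v where "v = inverse (1 - x * q 0)"
    have v: "v \<in> M" unfolding v_def by (rule unit) (rule q)
    have "1 = x * (\<Sum>i<N'. q i * inverse a ^ i)" using x0 unfolding q(2)[symmetric] by simp
    also have "\<dots> = x * q 0 + x * (\<Sum>i<k. q (Suc i) * inverse a ^ Suc i)"
      unfolding k sum.lessThan_Suc_shift by (simp add: distrib_left)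
    finally have "1 - x * q 0 = x * (\<Sum>i<k. q (Suc i) * inverse a ^ Suc i)" by (simp add: algebra_simps)
    moreover have "1 - x * q 0 \<noteq> 0" by (rule nz) (rule q)
    ultimately have one: "1 = v * (x * (\<Sum>i<k. q (Suc i) * inverse a ^ Suc i))"
      unfolding v_def by (metis left_inverse)
    define d where "d i = v * q (k - i)" for i
    have "a ^ k = a ^ k * (v * (x * (\<Sum>i<k. q (Suc i) * inverse a ^ Suc i)))"
      unfolding one[symmetric] by simp
    also have "\<dots> = x * (\<Sum>i<k. v * q (Suc i) * (a ^ k * inverse a ^ Suc i))"
      by (simp only: sum_distrib_left mult_ac)
    also have "(\<Sum>i<k. v * q (Suc i) * (a ^ k * inverse a ^ Suc i)) = (\<Sum>i<k. v * q (Suc i) * a ^ (k - Suc i))"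
    proof (intro sum.cong refl)
      fix i assume "i \<in> {..<k}"
      then have "a ^ k = a ^ (k - Suc i) * a ^ Suc i" by (simp add: power_add[symmetric] del: power_Suc)
      then show "v * q (Suc i) * (a ^ k * inverse a ^ Suc i) = v * q (Suc i) * a ^ (k - Suc i)"
        using prems(1) by (simp add: power_inverse del: power_Suc)
    qed
    also have "\<dots> = (\<Sum>i<k. d i * a ^ i)"
      by (subst sum.nat_diff_reindex[symmetric]) (intro sum.cong refl, auto simp: d_def Suc_diff_Suc)
    finally have ak: "a ^ k = x * (\<Sum>i<k. d i * a ^ i)" .
    have kn: "k \<le> n" using prems(4) n k by simp
    define c' where "c' i = c i + (if n - k \<le> i then c n * (x * d (i - (n - k))) else 0)" for i
    have dM: "d i \<in> M" for i unfolding d_def using v q(1) m(4) by blast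
    have c'M: "\<forall>i. c' i \<in> M" unfolding c'_def using c(1) dM xM m(2,4,6) by simp
    have "c n * a ^ n = c n * (a ^ (n - k) * (x * (\<Sum>i<k. d i * a ^ i)))"
      unfolding ak[symmetric] using kn by (simp flip: power_add)
    also have "\<dots> = (\<Sum>i<k. c n * (x * d i) * a ^ (i + (n - k)))"
      by (simp only: sum_distrib_left power_add mult_ac)
    also have "\<dots> = (\<Sum>i\<in>{n - k..<n}. c n * (x * d (i - (n - k))) * a ^ i)"
      using kn by (intro sum.reindex_bij_witness[of _ "\<lambda>i. i - (n - k)" "\<lambda>i. i + (n - k)"]) auto
    also have "\<dots> = (\<Sum>i<n. (if n - k \<le> i then c n * (x * d (i - (n - k))) else 0) * a ^ i)"
      by (intro sum.mono_neutral_cong_left) auto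
    finally have "inverse x = (\<Sum>i<n. c' i * a ^ i)"
      unfolding c(2) n c'_def by (simp add: sum.distrib distrib_right)
    then have "rep a n" unfolding rep_def using c'M by blast
    then show False using prems(5)[of n] n by simp
  qed
  have val: "a \<in> M \<or> inverse a \<in> M" for a
  proof (rule ccontr)
    assume "\<not> (a \<in> M \<or> inverse a \<in> M)"
    then have "a \<notin> M" "inverse a \<notin> M" "a \<noteq> 0" using m(2) by auto
    then have ex: "\<exists>N. rep a N" "\<exists>N. rep (inverse a) N"
      using ext unfolding rep_def by blast+
    define N N' where "N = (LEAST N. rep a N)" and "N' = (LEAST N. rep (inverse a) N)"
    have N: "rep a N" "\<And>K. rep a K \<Longrightarrow> N \<le> K"
      unfolding N_def using LeastI_ex[OF ex(1)] Least_le by auto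
    have N': "rep (inverse a) N'" "\<And>K. rep (inverse a) K \<Longrightarrow> N' \<le> K"
      unfolding N'_def using LeastI_ex[OF ex(2)] Least_le by auto
    show False
      using core[of a N N'] core[of "inverse a" N' N] N N' \<open>a \<noteq> 0\<close> by (cases "N' \<le> N") auto
  qed
  show thesis using that M val by blast
qed

section \<open>The local ring of a branch and a valuation ring dominating it\<close>

text \<open>
  The model is the order of vanishing along the branch \<open>f = 0\<close>, that is, the order in \<open>t\<close> of the
  image of a power series in the normalization \<open>k[[t]]\<close> of \<open>k[[x,y]]/(f)\<close>. Assumption \<open>residue\<close> says
  that the residue field is \<open>k\<close>. The number \<open>C\<close> is a conductor exponent: the ideal \<open>t ^ C k[[t]]\<close> is
  contained in the image of \<open>k[[x,y]]\<close>, which the last two assumptions express without mentioning \<open>t\<close>.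
\<close>
locale branch_valuation =
  fixes f :: "'k::alg_closed_field fps2" and w :: "'k fps2 \<Rightarrow> enat" and C :: nat
  assumes infinite_iff: "w a = \<infinity> \<longleftrightarrow> f dvd a"
    and mult: "w (a * b) = w a + w b"
    and add: "min (w a) (w b) \<le> w (a + b)"
    and residue: "w a = w b \<Longrightarrow> w a \<noteq> \<infinity> \<Longrightarrow> \<exists>c. w a < w (a - scalar c * b)"
    and conductor: "w a + enat C \<le> w b \<Longrightarrow> \<exists>s. f dvd b - s * a"
    and attained: "C \<le> n \<Longrightarrow> \<exists>a. w a = enat n"

lemma to_fract_sum: "to_fract (sum h I) = (\<Sum>i\<in>I. to_fract (h i))"
  by (induction I rule: infinite_finite_induct) simp_all

lemma to_fract_power: "to_fract (a ^ n) = to_fract a ^ n"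
  by (induction n) simp_all

lemma enat_le_by_bounds:
  fixes s t :: enat assumes "\<And>m. enat m \<le> s \<Longrightarrow> enat m \<le> t" shows "s \<le> t"
proof (cases s)
  case (enat n)
  then show ?thesis using assms[of n] by simp
next
  case infinity
  show ?thesis
  proof (cases t)
    case (enat n)
    then show ?thesis using assms[of "Suc n"] infinity by simp
  qed simp
qed

text \<open>
  The function field of the branch \<open>f = 0\<close> is the residue field of the localization of \<open>k[[x,y]]\<close> at
  the prime \<open>f\<close>. Computing with this localization inside the fraction field of \<open>k[[x,y]]\<close>, modulo
  its maximal ideal, replaces the function field, which as a type would depend on \<open>f\<close>.
\<close>
locale prime_power_series =
  fixes f :: "'k::alg_closed_field fps2"
  assumes not_unit: "\<not> f dvd 1"
    and prime: "f dvd a * b \<Longrightarrow> f dvd a \<or> f dvd b"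
begin

definition localization :: "'k fps2 fract set" where
  "localization = {to_fract a / to_fract b | a b. \<not> f dvd b}"

definition maximal :: "'k fps2 fract set" where
  "maximal = {to_fract a / to_fract b | a b. f dvd a \<and> \<not> f dvd b}"

lemma nonzero: "\<not> f dvd a \<Longrightarrow> to_fract a \<noteq> 0"
  by auto

lemma localizationI: "\<not> f dvd b \<Longrightarrow> u * to_fract b = to_fract a \<Longrightarrow> u \<in> localization"
  unfolding localization_def
  by (rule CollectI, rule exI[of _ a], rule exI[of _ b]) (use nonzero[of b] in \<open>simp add: nonzero_eq_divide_eq\<close>)

lemma maximalI: "\<not> f dvd b \<Longrightarrow> f dvd a \<Longrightarrow> u * to_fract b = to_fract a \<Longrightarrow> u \<in> maximal"
  unfolding maximal_def
  by (rule CollectI, rule exI[of _ a], rule exI[of _ b]) (use nonzero[of b] in \<open>simp add: nonzero_eq_divide_eq\<close>)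

lemma localizationE:
  assumes "u \<in> localization"
  obtains a b where "\<not> f dvd b" "u * to_fract b = to_fract a" "to_fract b \<noteq> 0"
proof -
  obtain a b where "u = to_fract a / to_fract b" "\<not> f dvd b"
    using assms unfolding localization_def by blast
  with nonzero[of b] show thesis by (intro that[of b a]) simp_all
qed

lemma maximalE:
  assumes "u \<in> maximal"
  obtains a b where "\<not> f dvd b" "f dvd a" "u * to_fract b = to_fract a" "to_fract b \<noteq> 0"
proof -
  obtain a b where "u = to_fract a / to_fract b" "f dvd a" "\<not> f dvd b"
    using assms unfolding maximal_def by blast
  with nonzero[of b] show thesis by (intro that[of b a]) simp_all
qed

lemma prime': "\<not> f dvd a \<Longrightarrow> \<not> f dvd b \<Longrightarrow> \<not> f dvd a * b"
  using prime by blast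

lemma prime_power: "\<not> f dvd a \<Longrightarrow> \<not> f dvd a ^ n"
  by (induction n) (use not_unit prime' in auto)

lemma to_fract_localization: "to_fract a \<in> localization"
  using not_unit by (intro localizationI[of 1 _ a]) auto

lemma to_fract_maximal_iff: "to_fract a \<in> maximal \<longleftrightarrow> f dvd a"
proof
  assume "to_fract a \<in> maximal"
  then obtain c b where h: "\<not> f dvd b" "f dvd c" "to_fract a * to_fract b = to_fract c"
    by (rule maximalE)
  from h(3) have "to_fract (a * b) = to_fract c" by simp
  then have "a * b = c" by (simp only: to_fract_eq_iff)
  then show "f dvd a" using h prime by blast
next
  assume "f dvd a"
  then show "to_fract a \<in> maximal" using not_unit by (intro maximalI[of 1 a]) auto
qed

lemma maximal_subset: "maximal \<subseteq> localization"
  unfolding maximal_def localization_def by blast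

lemma is_subring_localization: "is_subring localization"
  unfolding is_subring_def
proof (intro conjI ballI)
  show "1 \<in> localization" using to_fract_localization[of 1] by simp
  fix u v assume "u \<in> localization" "v \<in> localization"
  then obtain a b c d where h: "\<not> f dvd b" "u * to_fract b = to_fract a"
      "\<not> f dvd d" "v * to_fract d = to_fract c" by (elim localizationE) blast
  have "(u - v) * to_fract (b * d) = (u * to_fract b) * to_fract d - (v * to_fract d) * to_fract b"
    by (simp add: algebra_simps)
  also have "\<dots> = to_fract (a * d - c * b)" unfolding h by simp
  finally show "u - v \<in> localization" by (rule localizationI[OF prime'[OF h(1,3)]])
  have "u * v * to_fract (b * d) = (u * to_fract b) * (v * to_fract d)"
    by (simp add: algebra_simps)
  also have "\<dots> = to_fract (a * c)" unfolding h by simp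
  finally show "u * v \<in> localization" by (rule localizationI[OF prime'[OF h(1,3)]])
qed

lemmas localization_closed = is_subringD[OF is_subring_localization]

lemma maximal_mult: "u \<in> maximal \<Longrightarrow> v \<in> localization \<Longrightarrow> u * v \<in> maximal"
proof -
  assume "u \<in> maximal" "v \<in> localization"
  then obtain a b c d where h: "\<not> f dvd b" "f dvd a" "u * to_fract b = to_fract a"
      "\<not> f dvd d" "v * to_fract d = to_fract c" by (elim localizationE maximalE) blast
  have "u * v * to_fract (b * d) = (u * to_fract b) * (v * to_fract d)"
    by (simp add: algebra_simps)
  also have "\<dots> = to_fract (a * c)" unfolding h by simp
  finally show "u * v \<in> maximal" by (rule maximalI[OF prime'[OF h(1,4)], rotated]) (use h(2) in auto)
qed

lemma maximal_diff: "u \<in> maximal \<Longrightarrow> v \<in> maximal \<Longrightarrow> u - v \<in> maximal"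
proof -
  assume "u \<in> maximal" "v \<in> maximal"
  then obtain a b c d where h: "\<not> f dvd b" "f dvd a" "u * to_fract b = to_fract a"
      "\<not> f dvd d" "f dvd c" "v * to_fract d = to_fract c" by (elim maximalE) blast
  have "(u - v) * to_fract (b * d) = (u * to_fract b) * to_fract d - (v * to_fract d) * to_fract b"
    by (simp add: algebra_simps)
  also have "\<dots> = to_fract (a * d - c * b)" unfolding h by simp
  finally show "u - v \<in> maximal" by (rule maximalI[OF prime'[OF h(1,4)], rotated]) (use h(2,5) in auto)
qed

lemma inverse_localization:
  assumes "u \<in> localization" "u \<notin> maximal"
  shows "inverse u \<in> localization" "inverse u \<notin> maximal" "u \<noteq> 0"
proof -
  obtain a b where h: "\<not> f dvd b" "u * to_fract b = to_fract a" "to_fract b \<noteq> 0"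
    using assms(1) by (rule localizationE)
  have a: "\<not> f dvd a" using h(1,2) assms(2) maximalI by blast
  then show u: "u \<noteq> 0" using h(2) nonzero by fastforce
  have "inverse u * to_fract a = inverse u * u * to_fract b" unfolding h(2)[symmetric] by simp
  then have eq: "inverse u * to_fract a = to_fract b" using u by simp
  then show "inverse u \<in> localization" by (rule localizationI[OF a])
  show "inverse u \<notin> maximal"
  proof
    assume "inverse u \<in> maximal"
    then have "inverse u * to_fract a \<in> maximal" using to_fract_localization maximal_mult by blast
    then show False unfolding eq using h(1) to_fract_maximal_iff by blast
  qed
qed

text \<open>
  With a common denominator, linear relations between elements of the localization become linear
  relations between power series.
\<close>
lemma common_denominator:
  assumes "finite I" "\<And>i. i \<in> I \<Longrightarrow> u i \<in> localization"
  shows "\<exists>b. \<not> f dvd b \<and> (\<forall>i\<in>I. \<exists>a. u i * to_fract b = to_fract a)"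
  using assms
proof (induction I rule: finite_induct)
  case empty
  then show ?case using not_unit by blast
next
  case (insert j I)
  have "\<exists>b. \<not> f dvd b \<and> (\<forall>i\<in>I. \<exists>a. u i * to_fract b = to_fract a)"
    by (rule insert.IH) (use insert.prems in simp)
  then obtain b where b: "\<not> f dvd b" "\<forall>i\<in>I. \<exists>a. u i * to_fract b = to_fract a" by blast
  have "u j \<in> localization" using insert.prems by simp
  then obtain d c where d: "\<not> f dvd d" "u j * to_fract d = to_fract c" by (rule localizationE)
  have "\<exists>a. u i * to_fract (b * d) = to_fract a" if "i \<in> insert j I" for i
  proof (cases "i = j")
    case True
    have "u j * to_fract (b * d) = (u j * to_fract d) * to_fract b" by simp
    also have "\<dots> = to_fract (c * b)" unfolding d by simp
    finally show ?thesis using True by blast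
  next
    case False
    with that b obtain a where a: "u i * to_fract b = to_fract a" by blast
    have "u i * to_fract (b * d) = (u i * to_fract b) * to_fract d" by simp
    also have "\<dots> = to_fract (a * d)" unfolding a by simp
    finally show ?thesis by blast
  qed
  then show ?case using prime'[OF b(1) d(1)] by blast
qed

end

text \<open>
  A valuation ring \<open>V\<close> of the whole fraction field that contains the maximal ideal of the
  localization: the image of its intersection with the localization is a valuation ring of the
  function field of the branch. It contains the image of \<open>k[[x,y]]\<close> and has \<open>x\<close> as a nonunit.
\<close>
locale branch_place = prime_power_series f for f :: "'k::alg_closed_field fps2" +
  fixes V :: "'k fps2 fract set"
  assumes x_not_dvd: "\<not> xvar dvd f" and f_not_dvd_x: "\<not> f dvd xvar"
    and xpower: "\<not> f dvd a \<Longrightarrow> \<exists>v \<beta> \<gamma>. xvar ^ v = \<beta> * a + \<gamma> * f"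
    and V_ring: "is_subring V"
    and V_series: "to_fract a \<in> V" and V_maximal: "maximal \<subseteq> V"
    and V_x: "inverse (to_fract xvar) \<notin> V"
    and V_valuation: "u \<in> V \<or> inverse u \<in> V"
begin

lemmas V_closed = is_subringD[OF V_ring]

text \<open>
  The maximal ideal of \<open>V\<close>.
\<close>
definition V_ideal :: "'k fps2 fract set" where
  "V_ideal = {u \<in> V. u = 0 \<or> inverse u \<notin> V}"

abbreviation "tx \<equiv> to_fract xvar"

lemma tx_nonzero [simp]: "tx \<noteq> 0" by simp

lemma tx_units: "tx \<in> localization" "tx \<notin> maximal"
  using to_fract_localization to_fract_maximal_iff f_not_dvd_x by auto

lemma V_ideal_mult: assumes "u \<in> V_ideal" "v \<in> V" shows "u * v \<in> V_ideal"
proof (cases "u * v = 0")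
  case True
  then have "u * v = 0" .
  then show ?thesis unfolding V_ideal_def using V_closed(2) by (simp only: mem_Collect_eq simp_thms)
next
  case False
  then have "inverse u = inverse (u * v) * v" by (simp add: field_simps)
  then have "inverse (u * v) \<in> V \<Longrightarrow> inverse u \<in> V" using V_closed(4) assms(2) by metis
  then show ?thesis using assms False V_closed(4) unfolding V_ideal_def by auto
qed

lemma V_ideal_add: assumes "u \<in> V_ideal" "v \<in> V_ideal" shows "u + v \<in> V_ideal"
proof (cases "u = 0 \<or> v = 0")
  case True
  then show ?thesis using assms by auto
next
  case False
  have V: "u \<in> V" "v \<in> V" using assms unfolding V_ideal_def by auto
  consider "u / v \<in> V" | "v / u \<in> V" using V_valuation[of "u / v"] by auto
  then show ?thesis
  proof cases
    case 1
    then have "v * (u / v + 1) \<in> V_ideal" using V_ideal_mult assms V_closed(1,6) by blast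
    also have "v * (u / v + 1) = u + v" using False by (simp add: field_simps)
    finally show ?thesis .
  next
    case 2
    then have "u * (1 + v / u) \<in> V_ideal" using V_ideal_mult assms V_closed(1,6) by blast
    also have "u * (1 + v / u) = u + v" using False by (simp add: field_simps)
    finally show ?thesis .
  qed
qed

lemma V_ideal_subset: "u \<in> V_ideal \<Longrightarrow> u \<in> V" unfolding V_ideal_def by blast

lemma V_ideal_uminus: "u \<in> V_ideal \<Longrightarrow> - u \<in> V_ideal"
  using V_ideal_mult[of u "- 1"] V_closed(1,5) by simp

lemma V_ideal_diff: "u \<in> V_ideal \<Longrightarrow> v \<in> V_ideal \<Longrightarrow> u - v \<in> V_ideal"
  using V_ideal_add[OF _ V_ideal_uminus] by (metis add_uminus_conv_diff)

lemma V_ideal_zero: "0 \<in> V_ideal" unfolding V_ideal_def using V_closed(2) by simp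

lemma V_ideal_sum: "(\<And>i. i \<in> I \<Longrightarrow> h i \<in> V_ideal) \<Longrightarrow> sum h I \<in> V_ideal"
  by (induction I rule: infinite_finite_induct) (auto intro: V_ideal_zero V_ideal_add)

lemma V_ideal_not_inverse: "u \<in> V_ideal \<Longrightarrow> u \<noteq> 0 \<Longrightarrow> inverse u \<notin> V"
  unfolding V_ideal_def by blast

lemma not_V_inverse: "u \<notin> V \<Longrightarrow> inverse u \<in> V_ideal"
  using V_valuation[of u] V_closed(2) unfolding V_ideal_def by auto

lemma one_not_V_ideal: "1 \<notin> V_ideal"
  unfolding V_ideal_def using V_closed(1) by simp

lemma V_ideal_prime: assumes "u \<in> V" "v \<in> V" "u * v \<in> V_ideal" shows "u \<in> V_ideal \<or> v \<in> V_ideal"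
proof (rule ccontr)
  assume "\<not> ?thesis"
  then have h: "u \<noteq> 0" "v \<noteq> 0" "inverse u \<in> V" "inverse v \<in> V" using assms(1,2) unfolding V_ideal_def by auto
  then have "u * v * (inverse u * inverse v) \<in> V_ideal" using V_ideal_mult assms(3) V_closed(4) by blast
  also have "u * v * (inverse u * inverse v) = 1" using h by (simp add: field_simps)
  finally show False using one_not_V_ideal by blast
qed

lemma tx_V_ideal: "tx \<in> V_ideal"
  unfolding V_ideal_def using V_series V_x by simp

lemma maximal_subset_V_ideal: "u \<in> maximal \<Longrightarrow> u \<in> V_ideal"
proof -
  assume "u \<in> maximal"
  then have "u * inverse tx \<in> V"
    using inverse_localization(1)[OF tx_units] maximal_mult V_maximal by blast
  then have "tx * (u * inverse tx) \<in> V_ideal" using tx_V_ideal V_ideal_mult by blast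
  then show ?thesis by (simp add: field_simps)
qed

abbreviation sc :: "'k \<Rightarrow> 'k fps2 fract" where "sc c \<equiv> to_fract (scalar c)"

lemma sc_not_V_ideal: "c \<noteq> 0 \<Longrightarrow> sc c \<notin> V_ideal"
proof
  assume "c \<noteq> 0" "sc c \<in> V_ideal"
  then have "sc c * sc (inverse c) \<in> V_ideal" using V_series V_ideal_mult by blast
  also have "sc c * sc (inverse c) = 1"
    using \<open>c \<noteq> 0\<close> by (simp flip: to_fract_mult scalar_mult)
  finally show False using one_not_V_ideal by blast
qed

text \<open>
  An upper bound for the degree over \<open>k((x))\<close> of the function field of the branch.
\<close>
definition rank :: nat where "rank = weierstrass_degree f"

text \<open>
  After clearing denominators, Weierstrass division by \<open>f\<close> reduces the elements to polynomials in \<open>y\<close>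
  of degree less than \<open>rank\<close> over \<open>k[[x]]\<close>, and \<open>rank + 1\<close> such polynomials are dependent.
\<close>
lemma linear_dependence:
  assumes "\<And>i. i \<le> rank \<Longrightarrow> u i \<in> localization"
  shows "\<exists>c. (\<exists>i\<le>rank. c i \<noteq> 0) \<and> (\<Sum>i\<le>rank. to_fract (fps_const (c i)) * u i) \<in> maximal"
proof -
  obtain b where b: "\<not> f dvd b" "\<forall>i\<in>{..rank}. \<exists>a. u i * to_fract b = to_fract a"
    using common_denominator[of "{..rank}" u] assms by auto
  then obtain a where a: "\<And>i. i \<le> rank \<Longrightarrow> u i * to_fract b = to_fract (a i)" by (metis atMost_iff)
  have "\<exists>q. \<forall>j\<ge>rank. (a i - f * q) $ j = 0" for i
    using weierstrass_division[of rank f "a i"] weierstrass_degree[OF x_not_dvd] unfolding rank_def by blast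
  then obtain q where q: "\<And>i j. rank \<le> j \<Longrightarrow> (a i - f * q i) $ j = 0" by metis
  have "\<exists>c. (\<exists>i\<in>{..rank}. c i \<noteq> 0) \<and> (\<forall>j\<in>{..<rank}. (\<Sum>i\<in>{..rank}. c i * (a i - f * q i) $ j) = 0)"
    by (rule homogeneous_system_nontrivial) auto
  then obtain c where c: "\<exists>i\<in>{..rank}. c i \<noteq> 0"
      "\<And>j. j < rank \<Longrightarrow> (\<Sum>i\<in>{..rank}. c i * (a i - f * q i) $ j) = 0" by blast
  have "(\<Sum>i\<le>rank. fps_const (c i) * (a i - f * q i)) = 0"
  proof (rule fps_ext)
    fix j
    show "(\<Sum>i\<le>rank. fps_const (c i) * (a i - f * q i)) $ j = 0 $ j"
      using c(2)[of j] q[of j] by (cases "j < rank") (simp_all add: fps_sum_nth)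
  qed
  then have eq: "(\<Sum>i\<le>rank. fps_const (c i) * a i) = f * (\<Sum>i\<le>rank. fps_const (c i) * q i)"
    by (simp add: algebra_simps sum_subtractf sum_distrib_left)
  have "(\<Sum>i\<le>rank. to_fract (fps_const (c i)) * u i) * to_fract b
      = to_fract (\<Sum>i\<le>rank. fps_const (c i) * a i)"
    by (simp add: sum_distrib_right to_fract_sum mult.assoc a)
  also have "\<dots> = to_fract (f * (\<Sum>i\<le>rank. fps_const (c i) * q i))" unfolding eq ..
  finally have "(\<Sum>i\<le>rank. to_fract (fps_const (c i)) * u i) \<in> maximal"
    by (rule maximalI[OF b(1) dvd_triv_left])
  then show ?thesis using c(1) by (intro exI[of _ c]) auto
qed

lemma divide_tx_maximal: "tx ^ n * u \<in> maximal \<Longrightarrow> u \<in> maximal"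
proof (induction n)
  case (Suc n)
  then have "tx ^ Suc n * u * inverse tx \<in> maximal"
    using inverse_localization(1)[OF tx_units] maximal_mult by blast
  also have "tx ^ Suc n * u * inverse tx = tx ^ n * u" by (simp add: field_simps)
  finally show ?case by (rule Suc.IH)
qed simp

text \<open>
  In the valuation ring modulo \<open>x\<close>, any \<open>rank + 1\<close> elements are dependent over \<open>k\<close>: divide a relation
  over \<open>k[[x]]\<close> by the highest power of \<open>x\<close> common to its coefficients and reduce it modulo \<open>x\<close>.
\<close>
lemma residual_dependence:
  assumes "\<And>i. i \<le> rank \<Longrightarrow> u i \<in> localization" "\<And>i. i \<le> rank \<Longrightarrow> u i \<in> V"
  shows "\<exists>c. (\<exists>i\<le>rank. c i \<noteq> 0) \<and> (\<exists>v\<in>V. (\<Sum>i\<le>rank. sc (c i) * u i) = tx * v)"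
proof -
  obtain c where c: "\<exists>i\<le>rank. c i \<noteq> 0" "(\<Sum>i\<le>rank. to_fract (fps_const (c i)) * u i) \<in> maximal"
    using linear_dependence assms(1) by blast
  \<comment> \<open>Collecting the coefficients in one series reduces the extraction of the common power of \<open>x\<close>
    to \<open>xvar_power_factor\<close>.\<close>
  define h where "h = Abs_fps (\<lambda>i. if i \<le> rank then c i else 0)"
  have "h \<noteq> 0" unfolding h_def using c(1) by (auto simp: fps_eq_iff)
  then obtain v b where b: "h = xvar ^ v * b" "\<not> xvar dvd b" by (rule xvar_power_factor)
  have hi: "h $ i = fps_X ^ v * b $ i" for i unfolding b(1) by (rule xvar_power_mult_nth)
  have ci: "fps_const (c i) = xvar ^ v * fps_const (b $ i)" if "i \<le> rank" for i
    using hi[of i] that by (simp add: h_def xvar_power)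
  obtain i where i: "b $ i $ 0 \<noteq> 0" using b(2) unfolding xvar_dvd_iff by blast
  have "i \<le> rank"
  proof (rule ccontr)
    assume "\<not> i \<le> rank"
    then have "b $ i = 0" using hi[of i] by (simp add: h_def)
    then show False using i by simp
  qed
  have "(\<Sum>i\<le>rank. to_fract (fps_const (c i)) * u i)
      = tx ^ v * (\<Sum>i\<le>rank. to_fract (fps_const (b $ i)) * u i)"
    unfolding sum_distrib_left
    by (intro sum.cong refl) (simp only: atMost_iff ci to_fract_mult to_fract_power mult.assoc)
  then have P: "(\<Sum>i\<le>rank. to_fract (fps_const (b $ i)) * u i) \<in> maximal"
    using c(2) by (simp only:) (rule divide_tx_maximal)
  define r where "r = (\<Sum>i\<le>rank. to_fract (fps_const (fps_shift 1 (b $ i))) * u i)"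
  have bi: "fps_const (b $ i) = scalar (b $ i $ 0) + xvar * fps_const (fps_shift 1 (b $ i))" for i
    using fps_const_split[of 0 "b $ i"] by simp
  have "(\<Sum>i\<le>rank. to_fract (fps_const (b $ i)) * u i) = (\<Sum>i\<le>rank. sc (b $ i $ 0) * u i) + tx * r"
    unfolding r_def by (subst bi) (simp add: sum.distrib distrib_right sum_distrib_left mult.assoc)
  then have eq: "(\<Sum>i\<le>rank. sc (b $ i $ 0) * u i)
      = (\<Sum>i\<le>rank. to_fract (fps_const (b $ i)) * u i) - tx * r" by simp
  have "(\<Sum>i\<le>rank. to_fract (fps_const (b $ i)) * u i) * inverse tx \<in> maximal"
    by (rule maximal_mult[OF P inverse_localization(1)[OF tx_units]])
  moreover have "r \<in> V" unfolding r_def using V_closed(4) V_series assms(2)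
    by (intro V_closed(8)) simp
  ultimately have "(\<Sum>i\<le>rank. to_fract (fps_const (b $ i)) * u i) * inverse tx - r \<in> V"
    using V_maximal by (intro V_closed(3)) auto
  moreover have "(\<Sum>i\<le>rank. sc (b $ i $ 0) * u i)
      = tx * ((\<Sum>i\<le>rank. to_fract (fps_const (b $ i)) * u i) * inverse tx - r)"
    unfolding eq by (simp add: field_simps)
  ultimately have "\<exists>v\<in>V. (\<Sum>i\<le>rank. sc (b $ i $ 0) * u i) = tx * v" by (rule bexI[rotated])
  moreover have "\<exists>i\<le>rank. b $ i $ 0 \<noteq> 0" using i \<open>i \<le> rank\<close> by blast
  ultimately show ?thesis by (intro exI[of _ "\<lambda>i. b $ i $ 0"] conjI)
qed

text \<open>
  Elements of pairwise different values below the value of \<open>x\<close> are independent over \<open>k\<close> modulo \<open>x\<close>,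
  so there are at most \<open>rank\<close> such values. This is the reason why the valuation is discrete.
\<close>
lemma no_descending_chain:
  assumes "s 0 = tx" and "\<And>i. s i \<in> localization \<and> s i \<in> V \<and> s i \<noteq> 0"
    and desc: "\<And>i. s i / s (Suc i) \<in> V_ideal"
  shows False
proof -
  have less: "s i / s (i + Suc d) \<in> V_ideal" for i d
  proof (induction d)
    case 0 then show ?case using desc[of i] by simp
  next
    case (Suc d)
    have "s i / s (i + Suc d) * (s (i + Suc d) / s (i + Suc (Suc d))) \<in> V_ideal"
      by (rule V_ideal_mult[OF Suc V_ideal_subset]) (use desc[of "i + Suc d"] in simp)
    also have "s i / s (i + Suc d) * (s (i + Suc d) / s (i + Suc (Suc d))) = s i / s (i + Suc (Suc d))"
      using assms(2)[of "i + Suc d"] by (simp del: add_Suc_right)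
    finally show ?case .
  qed
  have less': "s i / s j \<in> V_ideal" if "i < j" for i j
    using less[of i "j - i - 1"] that by simp
  have "\<exists>c. (\<exists>i\<le>rank. c i \<noteq> 0) \<and> (\<exists>v\<in>V. (\<Sum>i\<le>rank. sc (c i) * s (Suc i)) = tx * v)"
    by (rule residual_dependence) (simp_all add: assms(2))
  then obtain c v where c: "\<exists>i\<le>rank. c i \<noteq> 0" "v \<in> V" "(\<Sum>i\<le>rank. sc (c i) * s (Suc i)) = tx * v"
    by blast
  \<comment> \<open>The values of \<open>s i\<close> decrease, so the last nonzero coefficient belongs to the dominant term.\<close>
  define m where "m = Max {i. i \<le> rank \<and> c i \<noteq> 0}"
  have fin: "finite {i. i \<le> rank \<and> c i \<noteq> 0}" by simp
  have "m \<in> {i. i \<le> rank \<and> c i \<noteq> 0}" unfolding m_def using c(1) by (intro Max_in fin) blast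
  then have m: "m \<le> rank" "c m \<noteq> 0" by auto
  have above: "c i = 0" if "i \<le> rank" "m < i" for i
    using Max_ge[OF fin, of i] that unfolding m_def by fastforce
  have "(\<Sum>i\<le>rank. sc (c i) * s (Suc i)) = (\<Sum>i\<le>m. sc (c i) * s (Suc i))"
    using m(1) above by (intro sum.mono_neutral_right) auto
  also have "\<dots> = (\<Sum>i<m. sc (c i) * s (Suc i)) + sc (c m) * s (Suc m)"
    by (simp flip: lessThan_Suc_atMost)
  finally have eq: "sc (c m) * s (Suc m) = s 0 * v - (\<Sum>i<m. sc (c i) * s (Suc i))"
    unfolding c(3) assms(1) by (simp add: algebra_simps)
  have "sc (c m) = (s 0 * v - (\<Sum>i<m. sc (c i) * s (Suc i))) / s (Suc m)"
    unfolding eq[symmetric] using assms(2)[of "Suc m"] by simp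
  also have "\<dots> = s 0 / s (Suc m) * v - (\<Sum>i<m. s (Suc i) / s (Suc m) * sc (c i))"
    by (simp add: diff_divide_distrib sum_divide_distrib mult_ac)
  also have "\<dots> \<in> V_ideal"
    by (intro V_ideal_diff V_ideal_sum V_ideal_mult less' c(2) V_series) auto
  finally show False using sc_not_V_ideal[OF m(2)] by blast
qed

text \<open>
  The powers of \<open>u\<close> are dependent over \<open>k\<close> modulo \<open>x\<close>, so a nonzero polynomial over \<open>k\<close> vanishes at
  \<open>u\<close> modulo the prime ideal of nonunits. It splits into linear factors, and one of them vanishes.
\<close>
lemma residue_field:
  assumes "u \<in> localization" "u \<in> V"
  shows "\<exists>c. u - sc c \<in> V_ideal"
proof -
  define ev where "ev p = poly (map_poly sc p) u" for p
  have ev_mult: "ev ([:- c, 1:] * p) = (u - sc c) * ev p" for c p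
  proof -
    have eq: "map_poly sc ([:- c, 1:] * p) = [:- sc c, 1:] * map_poly sc p"
      by (rule poly_eqI) (simp add: coeff_map_poly coeff_pCons scalar_add scalar_mult scalar_uminus scalar_diff split: nat.split)
    show ?thesis unfolding ev_def eq by (simp add: algebra_simps)
  qed
  have ev_altdef: "ev p = (\<Sum>i\<le>degree p. sc (coeff p i) * u ^ i)" for p
  proof -
    have "degree (map_poly sc p) = degree p"
      by (rule degree_map_poly) (simp add: scalar_def)
    then show ?thesis unfolding ev_def poly_altdef by (simp add: coeff_map_poly)
  qed
  have ev_V: "ev p \<in> V" for p
    unfolding ev_altdef by (intro V_closed(8) V_closed(4) V_series V_closed(7) assms(2))
  have root: "\<exists>c. u - sc c \<in> V_ideal" if "p \<noteq> 0" "ev p \<in> V_ideal" for p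
    using that
  proof (induction "degree p" arbitrary: p)
    case 0
    then have "ev p = sc (coeff p 0)" unfolding ev_altdef by simp
    moreover have "coeff p 0 \<noteq> 0" using leading_coeff_neq_0[OF 0(2)] 0(1) by simp
    ultimately show ?case using 0 sc_not_V_ideal by simp
  next
    case (Suc n)
    then obtain c where "poly p c = 0" using alg_closed_imp_poly_has_root[of p] by auto
    then have "[:- c, 1:] dvd p" by (simp only: poly_eq_0_iff_dvd)
    then obtain r where r: "p = [:- c, 1:] * r" by (rule dvdE)
    then have "r \<noteq> 0" using Suc by auto
    then have "degree r = n" using Suc(2) unfolding r by (subst (asm) degree_mult_eq) auto
    have "(u - sc c) * ev r \<in> V_ideal" using Suc.prems(2) unfolding r ev_mult .
    then have "u - sc c \<in> V_ideal \<or> ev r \<in> V_ideal"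
      by (rule V_ideal_prime[rotated 2]) (intro V_closed(3) assms(2) V_series ev_V)+
    then show ?case using Suc.hyps(1)[of r] \<open>degree r = n\<close> \<open>r \<noteq> 0\<close> by blast
  qed
  have "\<exists>c. (\<exists>i\<le>rank. c i \<noteq> 0) \<and> (\<exists>v\<in>V. (\<Sum>i\<le>rank. sc (c i) * u ^ i) = tx * v)"
    by (rule residual_dependence) (rule localization_closed(7)[OF assms(1)] V_closed(7)[OF assms(2)])+
  then obtain c v where c: "\<exists>i\<le>rank. c i \<noteq> 0" "v \<in> V" "(\<Sum>i\<le>rank. sc (c i) * u ^ i) = tx * v"
    by blast
  define p where "p = (\<Sum>i\<le>rank. monom (c i) i)"
  have cp: "coeff p i = (if i \<le> rank then c i else 0)" for i
    unfolding p_def by (simp add: coeff_sum)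
  have "p \<noteq> 0"
  proof
    assume "p = 0"
    then have "c i = 0" if "i \<le> rank" for i using cp[of i] that by simp
    then show False using c(1) by blast
  qed
  moreover have "ev p = (\<Sum>i\<le>rank. sc (c i) * u ^ i)"
  proof -
    have "degree p \<le> rank" by (rule degree_le) (simp add: cp)
    then have "ev p = (\<Sum>i\<le>rank. sc (coeff p i) * u ^ i)"
      unfolding ev_altdef by (intro sum.mono_neutral_left) (auto simp: coeff_eq_0)
    then show ?thesis by (simp add: cp)
  qed
  moreover have "tx * v \<in> V_ideal" by (rule V_ideal_mult[OF tx_V_ideal c(2)])
  ultimately show ?thesis using root[of p] c(3) by simp
qed

text \<open>
  If no nonunit had the least positive value, one could descend from \<open>x\<close> indefinitely.
\<close>
lemma uniformizer_exists:
  "\<exists>p. p \<in> localization \<and> p \<notin> maximal \<and> p \<in> V_ideal \<and>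
     (\<forall>u\<in>localization \<inter> V_ideal. u / p \<in> V)"
proof (rule ccontr)
  assume no: "\<not> ?thesis"
  define Q where "Q u \<longleftrightarrow> u \<in> localization \<and> u \<notin> maximal \<and> u \<in> V_ideal" for u
  have "\<exists>s. \<forall>n. (Q (s n) \<and> (n = 0 \<longrightarrow> s n = tx)) \<and> s n / s (Suc n) \<in> V_ideal"
  proof (rule dependent_nat_choice)
    show "\<exists>u. Q u \<and> ((0::nat) = 0 \<longrightarrow> u = tx)" unfolding Q_def using tx_units tx_V_ideal by blast
  next
    fix p and n :: nat assume "Q p \<and> (n = 0 \<longrightarrow> p = tx)"
    then have p: "p \<in> localization" "p \<notin> maximal" "p \<in> V_ideal" unfolding Q_def by auto
    with no obtain u where u: "u \<in> localization" "u \<in> V_ideal" "u / p \<notin> V" by blast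
    have "u \<notin> maximal"
    proof
      assume "u \<in> maximal"
      then have "u * inverse p \<in> maximal" using inverse_localization(1)[OF p(1,2)] maximal_mult by blast
      then show False using u(3) V_maximal by (auto simp: divide_inverse)
    qed
    moreover have "p / u \<in> V_ideal" using not_V_inverse[OF u(3)] by simp
    ultimately show "\<exists>v. (Q v \<and> (Suc n = 0 \<longrightarrow> v = tx)) \<and> p / v \<in> V_ideal"
      unfolding Q_def using u by blast
  qed
  then obtain s where s: "\<And>n. Q (s n)" "s 0 = tx" "\<And>n. s n / s (Suc n) \<in> V_ideal" by blast
  have "s i \<in> localization \<and> s i \<in> V \<and> s i \<noteq> 0" for i
    using s(1)[of i] V_ideal_subset inverse_localization(3) unfolding Q_def by blast
  then show False by (rule no_descending_chain[OF s(2) _ s(3)])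
qed

end

section \<open>The discrete valuation of a branch\<close>

locale uniformized_place = branch_place f V for f :: "'k::alg_closed_field fps2" and V +
  fixes p :: "'k fps2 fract"
  assumes p_units: "p \<in> localization" "p \<notin> maximal" and p_V_ideal: "p \<in> V_ideal"
    and p_minimal: "u \<in> localization \<Longrightarrow> u \<in> V_ideal \<Longrightarrow> u / p \<in> V"
begin

lemma p_nonzero [simp]: "p \<noteq> 0"
  using inverse_localization(3) p_units by blast

lemma p_V: "p ^ n \<in> V" using p_V_ideal V_ideal_subset V_closed(7) by blast

lemma inverse_p_power: "inverse p ^ n \<in> localization"
  using inverse_localization(1)[OF p_units] localization_closed(7) by blast

lemma divide_p_localization: "u \<in> localization \<Longrightarrow> u / p ^ n \<in> localization"
  using localization_closed(4)[OF _ inverse_p_power] by (simp add: divide_inverse power_inverse)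

lemma divide_p_maximal: "u \<in> maximal \<Longrightarrow> u / p ^ n \<in> maximal"
  using maximal_mult[OF _ inverse_p_power] by (simp add: divide_inverse power_inverse)

lemma V_divide_antimono: assumes "u / p ^ n \<in> V" "m \<le> n" shows "u / p ^ m \<in> V"
proof -
  have "u / p ^ m = u / p ^ n * p ^ (n - m)"
    using assms(2) by (simp add: power_diff)
  then show ?thesis using V_closed(4)[OF assms(1) p_V] by simp
qed

lemma inverse_p_not_V: "1 / p \<notin> V"
  using V_ideal_not_inverse[OF p_V_ideal] by (simp add: divide_inverse)

lemma unit_divide_p_not_V: assumes "inverse u \<in> V" "u \<noteq> 0" shows "u / p \<notin> V"
proof
  assume "u / p \<in> V"
  then have "u / p * inverse u \<in> V" using assms(1) V_closed(4) by blast
  also have "u / p * inverse u = 1 / p" using assms(2) by simp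
  finally show False using inverse_p_not_V by blast
qed

lemma tx_bounded: "\<exists>e. tx / p ^ e \<notin> V"
proof (rule ccontr)
  assume "\<not> ?thesis"
  then have h: "tx / p ^ i \<in> V" for i by blast
  show False
  proof (rule no_descending_chain[of "\<lambda>i. tx / p ^ i"])
    show "tx / p ^ 0 = tx" by simp
    show "tx / p ^ i \<in> localization \<and> tx / p ^ i \<in> V \<and> tx / p ^ i \<noteq> 0" for i
      using h divide_p_localization[OF tx_units(1)] by simp
    show "tx / p ^ i / (tx / p ^ Suc i) \<in> V_ideal" for i
      using p_V_ideal by simp
  qed
qed

text \<open>
  Some \<open>x ^ v\<close> is a multiple of \<open>a\<close> modulo \<open>f\<close>, so the value of \<open>a\<close> is at most that of \<open>x ^ v\<close>, which
  is at most \<open>v * e\<close> when that of \<open>x\<close> is less than \<open>e\<close>.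
\<close>
lemma bounded:
  assumes "\<not> f dvd a" shows "\<exists>j. to_fract a / p ^ Suc j \<notin> V"
proof (rule ccontr)
  assume "\<not> ?thesis"
  then have h: "to_fract a / p ^ Suc j \<in> V" for j by blast
  obtain e where e: "tx / p ^ e \<notin> V" using tx_bounded by blast
  obtain v \<beta> \<gamma> where v: "xvar ^ v = \<beta> * a + \<gamma> * f" using xpower[OF assms] by blast
  let ?N = "v * e"
  have "tx ^ v / p ^ Suc ?N = to_fract \<beta> * (to_fract a / p ^ Suc ?N) + to_fract (\<gamma> * f) / p ^ Suc ?N"
    unfolding to_fract_power[symmetric] v by (simp add: add_divide_distrib)
  moreover have "to_fract (\<gamma> * f) / p ^ Suc ?N \<in> V"
    by (intro subsetD[OF V_maximal] divide_p_maximal) (simp only: to_fract_maximal_iff dvd_triv_right)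
  ultimately have 1: "tx ^ v / p ^ Suc ?N \<in> V"
    using h[of ?N] V_series V_closed(4,6) by (simp only:)
  let ?t = "inverse (tx / p ^ e)"
  have "?t ^ v \<in> V" using not_V_inverse[OF e] V_ideal_subset V_closed(7) by blast
  then have "tx ^ v / p ^ Suc ?N * ?t ^ v \<in> V" using 1 V_closed(4) by blast
  also have "tx ^ v / p ^ Suc ?N * ?t ^ v = 1 / p"
    by (simp add: power_mult[symmetric] power_divide power_inverse[symmetric] mult.commute[of v e] field_simps)
  finally show False using inverse_p_not_V by blast
qed

text \<open>
  The number of times \<open>p\<close> divides \<open>a\<close> in \<open>V\<close>. On multiples of \<open>f\<close> there is no bound; elsewhere the
  least \<open>j\<close> exists by \<open>bounded\<close>.
\<close>
definition val :: "'k fps2 \<Rightarrow> enat" where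
  "val a = (if f dvd a then \<infinity> else enat (LEAST j. to_fract a / p ^ Suc j \<notin> V))"

lemma val_ge_iff: "enat m \<le> val a \<longleftrightarrow> to_fract a / p ^ m \<in> V"
proof (cases "f dvd a")
  case True
  then have "to_fract a / p ^ m \<in> V"
    using V_maximal divide_p_maximal to_fract_maximal_iff by blast
  with True show ?thesis by (simp add: val_def)
next
  case False
  define L where "L = (LEAST j. to_fract a / p ^ Suc j \<notin> V)"
  have L: "to_fract a / p ^ Suc L \<notin> V"
    unfolding L_def by (rule LeastI_ex) (rule bounded[OF False])
  have "m \<le> L \<longleftrightarrow> to_fract a / p ^ m \<in> V"
  proof
    assume "m \<le> L"
    show "to_fract a / p ^ m \<in> V"
    proof (cases m)
      case 0
      then show ?thesis using V_series by simp
    next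
      case (Suc j)
      then have "j < L" using \<open>m \<le> L\<close> by simp
      then show ?thesis unfolding Suc L_def using not_less_Least by blast
    qed
  next
    assume "to_fract a / p ^ m \<in> V"
    then show "m \<le> L" using L V_divide_antimono by (meson not_less_eq_eq)
  qed
  then show ?thesis using False by (simp add: val_def L_def)
qed

lemma val_infinite_iff: "val a = \<infinity> \<longleftrightarrow> f dvd a" by (simp add: val_def)

lemma val_eq_iff:
  "val a = enat j \<longleftrightarrow> to_fract a / p ^ j \<in> V \<and> to_fract a \<noteq> 0 \<and> inverse (to_fract a / p ^ j) \<in> V"
proof
  assume eq: "val a = enat j"
  then have a: "\<not> f dvd a" by (auto simp: val_def split: if_splits)
  have in_V: "to_fract a / p ^ j \<in> V" using eq val_ge_iff[of j a] by simp
  have "\<not> enat (Suc j) \<le> val a" using eq by simp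
  then have "to_fract a / p ^ j / p \<notin> V" unfolding val_ge_iff by (simp add: mult.commute)
  then have "to_fract a / p ^ j \<notin> V_ideal"
    using p_minimal divide_p_localization to_fract_localization by blast
  then show "to_fract a / p ^ j \<in> V \<and> to_fract a \<noteq> 0 \<and> inverse (to_fract a / p ^ j) \<in> V"
    using in_V nonzero[OF a] unfolding V_ideal_def by simp
next
  assume h: "to_fract a / p ^ j \<in> V \<and> to_fract a \<noteq> 0 \<and> inverse (to_fract a / p ^ j) \<in> V"
  then have "to_fract a / p ^ j / p \<notin> V" by (intro unit_divide_p_not_V) auto
  then have "\<not> enat (Suc j) \<le> val a" unfolding val_ge_iff by (simp add: mult.commute)
  moreover have "enat j \<le> val a" using h unfolding val_ge_iff by blast
  ultimately show "val a = enat j" by (cases "val a") auto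
qed

lemma val_mult: "val (a * b) = val a + val b"
proof (cases "f dvd a \<or> f dvd b")
  case True
  then show ?thesis by (auto simp: val_def)
next
  case False
  then obtain i j where ij: "val a = enat i" "val b = enat j" by (auto simp: val_def)
  then have h: "to_fract a / p ^ i \<in> V" "to_fract a \<noteq> 0" "inverse (to_fract a / p ^ i) \<in> V"
      "to_fract b / p ^ j \<in> V" "to_fract b \<noteq> 0" "inverse (to_fract b / p ^ j) \<in> V"
    unfolding val_eq_iff by auto
  have eq: "to_fract (a * b) / p ^ (i + j) = (to_fract a / p ^ i) * (to_fract b / p ^ j)"
    by (simp add: power_add)
  have "val (a * b) = enat (i + j)"
    unfolding val_eq_iff eq inverse_mult_distrib[of "to_fract a / p ^ i"]
    by (intro conjI V_closed(4) h) (use h in simp)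
  then show ?thesis using ij by simp
qed

lemma val_add: "min (val a) (val b) \<le> val (a + b)"
proof (rule enat_le_by_bounds)
  fix m assume "enat m \<le> min (val a) (val b)"
  then have "to_fract a / p ^ m \<in> V" "to_fract b / p ^ m \<in> V" using val_ge_iff by auto
  then have "to_fract a / p ^ m + to_fract b / p ^ m \<in> V" by (rule V_closed(6))
  also have "to_fract a / p ^ m + to_fract b / p ^ m = to_fract (a + b) / p ^ m"
    by (simp add: add_divide_distrib)
  finally show "enat m \<le> val (a + b)" unfolding val_ge_iff .
qed

lemma val_residue:
  assumes "val a = val b" "val a \<noteq> \<infinity>"
  shows "\<exists>c. val a < val (a - scalar c * b)"
proof -
  obtain j where j: "val a = enat j" "val b = enat j" using assms by (cases "val a") auto
  have b: "\<not> f dvd b" using j val_infinite_iff by (metis enat.distinct(1))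
  have h: "to_fract a / p ^ j \<in> V" "to_fract b / p ^ j \<in> V" "inverse (to_fract b / p ^ j) \<in> V"
    "to_fract b \<noteq> 0"
    using j unfolding val_eq_iff by auto
  have "to_fract a / p ^ j * inverse (to_fract b / p ^ j) \<in> V" using h V_closed(4) by blast
  also have "to_fract a / p ^ j * inverse (to_fract b / p ^ j) = to_fract a * inverse (to_fract b)"
    using h by (simp add: field_simps)
  finally have V: "to_fract a * inverse (to_fract b) \<in> V" .
  have "to_fract b \<notin> maximal" using b to_fract_maximal_iff by blast
  then have "to_fract a * inverse (to_fract b) \<in> localization"
    using inverse_localization(1) to_fract_localization localization_closed(4) by blast
  then obtain c where "to_fract a * inverse (to_fract b) - sc c \<in> V_ideal"
    using residue_field V by blast
  then have "(to_fract a * inverse (to_fract b) - sc c) * (to_fract b / p ^ j) \<in> V_ideal"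
    using h(2) V_ideal_mult by blast
  also have "(to_fract a * inverse (to_fract b) - sc c) * (to_fract b / p ^ j)
      = to_fract (a - scalar c * b) / p ^ j"
    using h(4) by (simp add: field_simps)
  finally have "to_fract (a - scalar c * b) / p ^ j / p \<in> V"
    by (rule p_minimal[rotated]) (intro divide_p_localization to_fract_localization)
  then have "enat (Suc j) \<le> val (a - scalar c * b)"
    unfolding val_ge_iff by (simp add: mult.commute)
  then show ?thesis unfolding j(1) by (meson Suc_ile_eq)
qed

text \<open>
  The digits of \<open>u\<close> in base \<open>p\<close> are taken from \<open>k\<close>, by \<open>residue_field\<close>.
\<close>
lemma expansion:
  assumes "u \<in> localization" "u \<in> V"
  shows "\<exists>c. (u - (\<Sum>i<n. sc (c i) * p ^ i)) / p ^ n \<in> V"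
proof (induction n)
  case 0
  then show ?case using assms by simp
next
  case (Suc n)
  then obtain c where c: "(u - (\<Sum>i<n. sc (c i) * p ^ i)) / p ^ n \<in> V" by blast
  let ?r = "(u - (\<Sum>i<n. sc (c i) * p ^ i)) / p ^ n"
  have "?r \<in> localization"
    by (intro divide_p_localization localization_closed(3,8) assms localization_closed(4)
        to_fract_localization localization_closed(7) p_units)
  then obtain d where d: "?r - sc d \<in> V_ideal" using residue_field c by blast
  have "(?r - sc d) / p \<in> V"
    by (rule p_minimal[OF _ d]) (intro localization_closed(3) to_fract_localization \<open>?r \<in> localization\<close>)
  also have "(?r - sc d) / p = (u - (\<Sum>i<Suc n. sc ((c(n := d)) i) * p ^ i)) / p ^ Suc n"
    by (simp add: field_simps)
  finally show ?case by (rule exI[of _ "c(n := d)"])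
qed

definition ramification :: nat where "ramification = the_enat (val xvar)"

lemma val_xvar: "val xvar = enat ramification" "0 < ramification"
proof -
  have "val xvar \<noteq> \<infinity>" using val_infinite_iff f_not_dvd_x by blast
  then show eq: "val xvar = enat ramification" unfolding ramification_def by auto
  have "enat 1 \<le> val xvar"
    unfolding val_ge_iff using p_minimal[OF tx_units(1) tx_V_ideal] by simp
  then show "0 < ramification" unfolding eq by simp
qed

lemma tx_unit: "tx / p ^ ramification \<in> V" "p ^ ramification / tx \<in> V"
  using val_xvar(1) unfolding val_eq_iff by (auto simp: divide_inverse mult.commute)

lemma all_tx_divide_imp_maximal:
  assumes "u \<in> localization" "\<And>n. u / tx ^ n \<in> V"
  shows "u \<in> maximal"
proof -
  obtain b a where ab: "\<not> f dvd b" "u * to_fract b = to_fract a" using assms(1) by (rule localizationE)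
  have "enat n \<le> val a" for n
  proof -
    have "to_fract a / p ^ (ramification * n) = (u / tx ^ n) * to_fract b * (tx / p ^ ramification) ^ n"
      unfolding ab(2)[symmetric] by (simp add: power_mult power_divide)
    also have "\<dots> \<in> V" by (intro V_closed(4,7) assms(2) V_series tx_unit)
    finally have "enat (ramification * n) \<le> val a" unfolding val_ge_iff .
    moreover have "n \<le> ramification * n" using val_xvar(2) by simp
    ultimately show ?thesis by (meson enat_ord_simps(1) order_trans)
  qed
  then have "val a = \<infinity>" using enat_le_by_bounds[of \<infinity> "val a"] by simp
  then show ?thesis using ab val_infinite_iff maximalI by blast
qed

text \<open>
  Cutting off the expansion of \<open>u\<close> in base \<open>p\<close> at \<open>p ^ e\<close>, where \<open>e\<close> is the ramification index,
  leaves a multiple of \<open>x\<close>; iterating with the cofactor gives digits in base \<open>x\<close> for each of the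
  coefficients, which therefore are power series in \<open>x\<close>. The difference is divisible by all powers
  of \<open>x\<close> and vanishes on the branch.
\<close>
lemma integral_basis:
  assumes "u \<in> localization" "u \<in> V"
  shows "\<exists>c. u - (\<Sum>i<ramification. to_fract (fps_const (c i)) * p ^ i) \<in> maximal"
proof -
  let ?e = ramification
  define R where "R u c v \<longleftrightarrow> v \<in> localization \<and> v \<in> V \<and> u = (\<Sum>i<?e. sc (c i) * p ^ i) + tx * v"
    for u c v
  have "\<exists>c v. R u c v"
    if u: "u \<in> localization" "u \<in> V" for u
  proof -
    obtain c where c: "(u - (\<Sum>i<?e. sc (c i) * p ^ i)) / p ^ ?e \<in> V" using expansion[OF u] by blast
    let ?v = "(u - (\<Sum>i<?e. sc (c i) * p ^ i)) * inverse tx"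
    have "(u - (\<Sum>i<?e. sc (c i) * p ^ i)) / p ^ ?e * (p ^ ?e / tx) \<in> V"
      using c tx_unit(2) V_closed(4) by blast
    also have "(u - (\<Sum>i<?e. sc (c i) * p ^ i)) / p ^ ?e * (p ^ ?e / tx) = ?v"
      by (simp add: divide_inverse[of _ tx])
    finally have "?v \<in> V" .
    moreover have "?v \<in> localization"
      by (intro localization_closed(4,3,8) u to_fract_localization localization_closed(7) p_units
          inverse_localization(1)[OF tx_units])
    moreover have "u = (\<Sum>i<?e. sc (c i) * p ^ i) + tx * ?v"
      by (simp only: mult.left_commute[of tx] right_inverse[OF tx_nonzero] mult_1_right) simp
    ultimately show ?thesis unfolding R_def by blast
  qed
  then have "\<forall>u. \<exists>c v. u \<in> localization \<and> u \<in> V \<longrightarrow> R u c v" by blast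
  then obtain cf nx where "\<forall>u. u \<in> localization \<and> u \<in> V \<longrightarrow> R u (cf u) (nx u)" by metis
  then have nx: "u \<in> localization \<Longrightarrow> u \<in> V \<Longrightarrow>
      nx u \<in> localization \<and> nx u \<in> V \<and> u = (\<Sum>i<?e. sc (cf u i) * p ^ i) + tx * nx u" for u
    unfolding R_def by blast
  define t where "t n = (nx ^^ n) u" for n
  have t: "t n \<in> localization \<and> t n \<in> V" for n
    by (induction n) (use assms nx in \<open>auto simp: t_def\<close>)
  have t_step: "t n = (\<Sum>i<?e. sc (cf (t n) i) * p ^ i) + tx * t (Suc n)" for n
    using nx[of "t n"] t[of n] by (simp add: t_def)
  define c where "c i = Abs_fps (\<lambda>n. cf (t n) i)" for i
  \<comment> \<open>The error after removing the first \<open>n\<close> digits from \<open>u\<close> and from the coefficients alike.\<close>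
  define d where "d n = t n - (\<Sum>i<?e. to_fract (fps_const (fps_shift n (c i))) * p ^ i)" for n
  have d_V: "d n \<in> V" for n
    unfolding d_def using t[of n] by (intro V_closed(3,8)) (auto intro: V_closed(4) V_series p_V)
  have d_step: "d n = tx * d (Suc n)" for n
  proof -
    have "(\<Sum>i<?e. to_fract (fps_const (fps_shift n (c i))) * p ^ i)
        = (\<Sum>i<?e. sc (cf (t n) i) * p ^ i)
          + tx * (\<Sum>i<?e. to_fract (fps_const (fps_shift (Suc n) (c i))) * p ^ i)"
      unfolding sum_distrib_left sum.distrib[symmetric]
      by (intro sum.cong refl, subst fps_const_split) (simp add: c_def algebra_simps)
    then show ?thesis unfolding d_def by (subst t_step) (simp add: algebra_simps)
  qed
  have d_pow: "d 0 = tx ^ n * d n" for n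
  proof (induction n)
    case (Suc n)
    then show ?case by (simp add: d_step[of n] mult_ac)
  qed simp
  have d0: "d 0 = u - (\<Sum>i<?e. to_fract (fps_const (c i)) * p ^ i)"
    unfolding d_def by (simp add: t_def)
  have "d 0 \<in> localization"
    unfolding d0 by (intro localization_closed(3,8) assms localization_closed(4)
        to_fract_localization localization_closed(7) p_units)
  moreover have "d 0 / tx ^ n \<in> V" for n
    unfolding d_pow[of n] using d_V by simp
  ultimately have "d 0 \<in> maximal" by (rule all_tx_divide_imp_maximal)
  then show ?thesis unfolding d0 by (rule exI[of _ c])
qed

text \<open>
  Write \<open>p = q / r\<close> with \<open>r\<close> prime to \<open>f\<close>, and let \<open>e\<close> be the ramification index. By \<open>integral_basis\<close>,
  multiplication by \<open>r ^ e\<close> carries the valuation ring of the branch into the image of \<open>k[[x,y]]\<close>. A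
  power \<open>x ^ v\<close> is a multiple of \<open>r ^ e\<close> modulo \<open>f\<close> and so has the same property. Everything of value
  at least \<open>v * e\<close> is a multiple of \<open>x ^ v\<close> in the valuation ring.
\<close>
lemma conductor_exists:
  "\<exists>C. (\<forall>a b. val a + enat C \<le> val b \<longrightarrow> (\<exists>s. f dvd b - s * a)) \<and> (\<forall>n\<ge>C. \<exists>a. val a = enat n)"
proof -
  let ?e = ramification
  obtain r q where rq: "\<not> f dvd r" "p * to_fract r = to_fract q" "to_fract r \<noteq> 0"
    using p_units(1) by (rule localizationE)
  have "\<not> f dvd r ^ ?e" using rq(1) prime_power by blast
  then obtain v \<beta> \<gamma> where v: "xvar ^ v = \<beta> * r ^ ?e + \<gamma> * f" using xpower by blast
  have series: "\<exists>s. tx ^ v * u - to_fract s \<in> maximal" if u: "u \<in> localization" "u \<in> V" for u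
  proof -
    obtain c where c: "u - (\<Sum>i<?e. to_fract (fps_const (c i)) * p ^ i) \<in> maximal"
      using integral_basis[OF u] by blast
    define s where "s = (\<Sum>i<?e. fps_const (c i) * (q ^ i * r ^ (?e - i)))"
    have "to_fract s = (\<Sum>i<?e. to_fract (fps_const (c i)) * (p ^ i * to_fract r ^ ?e))"
    proof -
      have "to_fract (q ^ i * r ^ (?e - i)) = p ^ i * to_fract r ^ ?e" if "i < ?e" for i
      proof -
        have "to_fract (q ^ i * r ^ (?e - i)) = p ^ i * (to_fract r ^ i * to_fract r ^ (?e - i))"
          by (simp add: to_fract_power rq(2)[symmetric] power_mult_distrib mult_ac)
        also have "to_fract r ^ i * to_fract r ^ (?e - i) = to_fract r ^ ?e"
          using that by (simp flip: power_add)
        finally show ?thesis .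
      qed
      then show ?thesis unfolding s_def to_fract_sum to_fract_mult[of "fps_const _"]
        by (intro sum.cong refl) simp
    qed
    then have s: "to_fract s = (\<Sum>i<?e. to_fract (fps_const (c i)) * p ^ i) * to_fract r ^ ?e"
      by (simp add: sum_distrib_right mult.assoc)
    have "tx ^ v = to_fract \<beta> * to_fract r ^ ?e + to_fract \<gamma> * to_fract f"
      unfolding to_fract_power[symmetric] v by simp
    then have "tx ^ v * u - to_fract (\<beta> * s)
        = (u - (\<Sum>i<?e. to_fract (fps_const (c i)) * p ^ i)) * (to_fract \<beta> * to_fract r ^ ?e)
          + to_fract f * (to_fract \<gamma> * u)"
      by (simp add: s algebra_simps)
    moreover have "(u - (\<Sum>i<?e. to_fract (fps_const (c i)) * p ^ i)) * (to_fract \<beta> * to_fract r ^ ?e) \<in> maximal"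
      by (intro maximal_mult c localization_closed(4,7) to_fract_localization)
    moreover have "to_fract f * (to_fract \<gamma> * u) \<in> maximal"
      by (intro maximal_mult localization_closed(4) to_fract_localization u)
        (simp only: to_fract_maximal_iff dvd_refl)
    ultimately have "tx ^ v * u - to_fract (\<beta> * s) \<in> maximal"
      using maximal_diff[of _ "- _"] maximal_mult[of _ "- 1"] localization_closed(1,5) by fastforce
    then show ?thesis by blast
  qed
  define C where "C = v * ?e"
  have tx_pow: "p ^ C / tx ^ v \<in> V"
    using V_closed(7)[OF tx_unit(2), of v] unfolding C_def
    by (simp only: mult.commute[of v] power_mult power_divide)
  have "\<exists>s. f dvd b - s * a" if le: "val a + enat C \<le> val b" for a b
  proof (cases "f dvd a")
    case True
    then have "val b = \<infinity>" using le val_infinite_iff[of a] by simp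
    then show ?thesis using val_infinite_iff by (intro exI[of _ 0]) simp
  next
    case False
    then obtain j where j: "val a = enat j" by (auto simp: val_def)
    then have aV: "inverse (to_fract a / p ^ j) \<in> V" "to_fract a \<noteq> 0" unfolding val_eq_iff by auto
    have "to_fract b / p ^ (j + C) \<in> V" using le unfolding j val_ge_iff[symmetric] by simp
    then have "to_fract b / p ^ (j + C) * inverse (to_fract a / p ^ j) * (p ^ C / tx ^ v) \<in> V"
      using aV(1) tx_pow V_closed(4) by blast
    also have "to_fract b / p ^ (j + C) * inverse (to_fract a / p ^ j) * (p ^ C / tx ^ v)
        = to_fract b * (inverse (to_fract a) * inverse tx ^ v)"
      using aV(2) by (simp add: power_add field_simps)
    finally have V: "to_fract b * (inverse (to_fract a) * inverse tx ^ v) \<in> V" .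
    have "to_fract a \<notin> maximal" using False to_fract_maximal_iff by blast
    then have "to_fract b * (inverse (to_fract a) * inverse tx ^ v) \<in> localization"
      by (intro localization_closed(4,7) to_fract_localization inverse_localization(1) tx_units)
    then obtain s where s: "tx ^ v * (to_fract b * (inverse (to_fract a) * inverse tx ^ v)) - to_fract s \<in> maximal"
      using series V by blast
    have "(tx ^ v * (to_fract b * (inverse (to_fract a) * inverse tx ^ v)) - to_fract s) * to_fract a
        = to_fract (b - s * a)"
      using aV(2) by (simp add: field_simps)
    then have "to_fract (b - s * a) \<in> maximal"
      using maximal_mult[OF s to_fract_localization[of a]] by simp
    then show ?thesis using to_fract_maximal_iff by blast
  qed
  moreover have "\<exists>a. val a = enat n" if n: "C \<le> n" for n
  proof -
    have "p ^ (n - C) * (p ^ C / tx ^ v) \<in> V" by (intro V_closed(4) p_V tx_pow)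
    also have "p ^ (n - C) * (p ^ C / tx ^ v) = p ^ n * inverse tx ^ v"
      using n by (simp add: divide_inverse power_inverse mult.assoc[symmetric] flip: power_add)
    finally have V: "p ^ n * inverse tx ^ v \<in> V" .
    have "p ^ n * inverse tx ^ v \<in> localization"
      by (intro localization_closed(4,7) p_units inverse_localization(1) tx_units)
    then obtain s where "tx ^ v * (p ^ n * inverse tx ^ v) - to_fract s \<in> maximal"
      using series V by blast
    then have "(p ^ n - to_fract s) / p ^ n \<in> maximal"
      by (intro divide_p_maximal) (simp add: field_simps)
    then have m: "1 - to_fract s / p ^ n \<in> V_ideal"
      using maximal_subset_V_ideal by (simp add: diff_divide_distrib)
    have sV: "to_fract s / p ^ n \<in> V"
      using V_closed(3)[OF V_closed(1) V_ideal_subset[OF m]] by simp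
    have "to_fract s / p ^ n \<notin> V_ideal"
      using V_ideal_add[OF m, of "to_fract s / p ^ n"] one_not_V_ideal by auto
    then have "to_fract s / p ^ n \<noteq> 0" "inverse (to_fract s / p ^ n) \<in> V"
      using sV unfolding V_ideal_def by auto
    then have "val s = enat n" unfolding val_eq_iff using sV by simp
    then show ?thesis by blast
  qed
  ultimately show ?thesis by blast
qed

lemma branch_valuation_exists: "\<exists>w C. branch_valuation f w C"
proof -
  obtain C where "\<forall>a b. val a + enat C \<le> val b \<longrightarrow> (\<exists>s. f dvd b - s * a)"
      "\<forall>n\<ge>C. \<exists>a. val a = enat n"
    using conductor_exists by blast
  then have "branch_valuation f val C"
    by (intro branch_valuation.intro val_infinite_iff val_mult val_add val_residue) blast+
  then show ?thesis by blast
qed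

end

text \<open>
  The branch \<open>x = 0\<close> is already smooth, with parameter \<open>y\<close>. It is treated apart because finiteness
  over \<open>k[[x]]\<close>, on which the general construction rests, fails for it.
\<close>
lemma branch_valuation_xvar:
  fixes f :: "'k::alg_closed_field fps2"
  assumes fx: "f dvd xvar" and xf: "xvar dvd f"
  shows "branch_valuation f (\<lambda>a. if f dvd a then \<infinity> else enat (subdegree (at_x_zero a))) 0"
proof -
  have dvd: "f dvd a \<longleftrightarrow> at_x_zero a = 0" for a
    unfolding at_x_zero_eq_0_iff using fx xf dvd_trans by blast
  define lift where "lift = (\<lambda>h :: 'k fps. Abs_fps (\<lambda>i. fps_const (h $ i)))"
  have lift: "at_x_zero (lift h) = h" for h :: "'k fps" by (simp add: lift_def at_x_zero_def fps_eq_iff)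
  let ?w = "\<lambda>a. if at_x_zero a = 0 then \<infinity> else enat (subdegree (at_x_zero a))"
  have add: "min (?w a) (?w b) \<le> ?w (a + b)" for a b :: "'k fps2"
  proof (cases "at_x_zero a = 0 \<or> at_x_zero b = 0 \<or> at_x_zero (a + b) = 0")
    case False
    then show ?thesis
      using subdegree_add_ge[of "at_x_zero a" "at_x_zero b"]
      by (auto simp: at_x_zero_add min_def eq_neg_iff_add_eq_0)
  qed (auto simp: at_x_zero_add)
  have residue: "\<exists>c. ?w a < ?w (a - scalar c * b)" if "?w a = ?w b" "?w a \<noteq> \<infinity>" for a b :: "'k fps2"
  proof -
    let ?a = "at_x_zero a" and ?b = "at_x_zero b"
    define d where "d = subdegree ?a"
    have nz: "?a \<noteq> 0" "?b \<noteq> 0" and d: "subdegree ?b = d"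
      using that unfolding d_def by (auto split: if_splits)
    define c where "c = ?a $ d / ?b $ d"
    have "(?a - fps_const c * ?b) $ i = 0" if "i \<le> d" for i
    proof (cases "i = d")
      case True
      have "?b $ d \<noteq> 0" using nz d nth_subdegree_nonzero by blast
      then show ?thesis by (simp add: True c_def)
    next
      case False
      then show ?thesis using that d nth_less_subdegree_zero[of i ?a] nth_less_subdegree_zero[of i ?b]
        by (simp add: d_def)
    qed
    then have "?a - fps_const c * ?b = 0 \<or> d < subdegree (?a - fps_const c * ?b)"
      using nth_subdegree_nonzero by (metis not_le)
    then show ?thesis using nz
      by (intro exI[of _ c]) (auto simp: at_x_zero_diff at_x_zero_mult at_x_zero_scalar d_def)
  qed
  have conductor: "\<exists>s. at_x_zero (b - s * a) = 0" if "?w a + enat 0 \<le> ?w b" for a b :: "'k fps2"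
  proof -
    have "at_x_zero a dvd at_x_zero b"
    proof (cases "at_x_zero b = 0")
      case False
      then have "at_x_zero a \<noteq> 0" "subdegree (at_x_zero a) \<le> subdegree (at_x_zero b)"
        using that by (auto split: if_splits simp flip: zero_enat_def)
      then show ?thesis using False by (simp add: fps_dvd_iff)
    qed simp
    then obtain h where "at_x_zero b = at_x_zero a * h" by blast
    then have "at_x_zero (b - lift h * a) = 0"
      by (simp add: at_x_zero_diff at_x_zero_mult lift mult.commute)
    then show ?thesis by blast
  qed
  have attained: "\<exists>a :: 'k fps2. ?w a = enat n" for n
    by (rule exI[of _ "lift (fps_X ^ n)"]) (simp add: lift fps_X_power_subdegree)
  have mult: "?w (a * b) = ?w a + ?w b" for a b :: "'k fps2"
    by (simp add: at_x_zero_mult)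
  have infinite: "?w a = \<infinity> \<longleftrightarrow> at_x_zero a = 0" for a :: "'k fps2" by simp
  show ?thesis
    unfolding branch_valuation_def dvd
    by (intro conjI allI impI add residue conductor attained mult infinite)
qed

text \<open>
  For \<open>f\<close> not associated to \<open>x\<close>, Chevalley's theorem is applied to the ring \<open>A\<close> generated by
  \<open>k[[x,y]]\<close> and the maximal ideal of the localization at \<open>f\<close>. It does not contain \<open>1/x\<close>: otherwise
  \<open>f\<close> would divide the unit \<open>1 - x s\<close> for some \<open>s\<close>.
\<close>
theorem irreducible_has_branch_valuation:
  fixes f :: "'k::alg_closed_field fps2"
  assumes f: "Factorial_Ring.irreducible f"
  shows "\<exists>w C. branch_valuation f w C"
proof (cases "f dvd xvar")
  case True
  then have "xvar dvd f" using irreducible_dvd_irreducible[OF f irreducible_xvar] by blast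
  then show ?thesis using branch_valuation_xvar True by blast
next
  case fx: False
  then have xf: "\<not> xvar dvd f" using irreducible_dvd_irreducible[OF irreducible_xvar f] by blast
  interpret prime_power_series f
    using f irreducible_imp_prime_fps2[OF f] by unfold_locales (auto simp: Factorial_Ring.irreducible_def)
  define A where "A = {to_fract s + u | s u. u \<in> maximal}"
  have maximal_zero: "0 \<in> maximal" using to_fract_maximal_iff[of 0] by simp
  have sub: "is_subring A"
    unfolding is_subring_def
  proof (intro conjI ballI)
    show "1 \<in> A" unfolding A_def using maximal_zero
      by (intro CollectI exI[where x = 1] exI[where x = 0]) simp
    fix a b assume "a \<in> A" "b \<in> A"
    then obtain s t u v where h: "a = to_fract s + u" "b = to_fract t + v" "u \<in> maximal" "v \<in> maximal"
      unfolding A_def by blast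
    have "a - b = to_fract (s - t) + (u - v)" unfolding h by simp
    then show "a - b \<in> A" unfolding A_def using maximal_diff h by blast
    have "a * b = to_fract (s * t) + (v * to_fract s - u * (- to_fract t - v))"
      unfolding h by (simp add: algebra_simps)
    moreover have "v * to_fract s - u * (- to_fract t - v) \<in> maximal"
      using h(4) maximal_subset
      by (intro maximal_diff maximal_mult h localization_closed(3,5) to_fract_localization) auto
    ultimately show "a * b \<in> A" unfolding A_def by blast
  qed
  have x_in: "to_fract xvar \<in> A" unfolding A_def using maximal_zero
    by (intro CollectI exI[where x = xvar] exI[where x = 0]) simp
  have x_out: "inverse (to_fract xvar) \<notin> A"
  proof
    assume "inverse (to_fract xvar) \<in> A"
    then obtain s u where s: "inverse (to_fract xvar) = to_fract s + u" "u \<in> maximal"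
      unfolding A_def by blast
    have "1 = to_fract xvar * (to_fract s + u)" unfolding s(1)[symmetric] by simp
    then have "to_fract (1 - xvar * s) = u * to_fract xvar" by (simp add: algebra_simps)
    then have "to_fract (1 - xvar * s) \<in> maximal" using s(2) maximal_mult to_fract_localization by metis
    then have "f dvd 1 - xvar * s" using to_fract_maximal_iff by blast
    moreover have "1 - xvar * s dvd 1" by (simp add: is_unit_fps2_iff xvar_def)
    ultimately show False using not_unit dvd_trans by blast
  qed
  obtain V where V: "is_subring V" "A \<subseteq> V" "inverse (to_fract xvar) \<notin> V" "\<And>a. a \<in> V \<or> inverse a \<in> V"
    using valuation_ring_exists[OF sub x_in x_out] by blast
  have series: "to_fract a \<in> A" for a unfolding A_def using maximal_zero
    by (intro CollectI exI[where x = a] exI[where x = 0]) simp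
  have max: "maximal \<subseteq> A"
  proof
    fix u assume "u \<in> maximal"
    then show "u \<in> A" unfolding A_def
      by (intro CollectI exI[where x = "0 :: 'k fps2"] exI[where x = u]) simp
  qed
  interpret branch_place f V
    using fx xf V series max
    by unfold_locales (use xvar_power_in_ideal_of_irreducible[OF f xf] in auto)
  obtain p where "p \<in> localization" "p \<notin> maximal" "p \<in> V_ideal"
      "\<forall>u\<in>localization \<inter> V_ideal. u / p \<in> V"
    using uniformizer_exists by blast
  then interpret uniformized_place f V p
    by unfold_locales auto
  show ?thesis by (rule branch_valuation_exists)
qed

section \<open>Colength of an ideal with two generators and intersection numbers\<close>

definition ideal2 :: "'k::field fps2 \<Rightarrow> 'k fps2 \<Rightarrow> 'k fps2 set" where
  "ideal2 f g = {\<alpha> * f + \<beta> * g | \<alpha> \<beta>. True}"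

lemma ideal2I: "s = \<alpha> * f + \<beta> * g \<Longrightarrow> s \<in> ideal2 f g"
  unfolding ideal2_def by blast

lemma ideal2E: assumes "s \<in> ideal2 f g" obtains \<alpha> \<beta> where "s = \<alpha> * f + \<beta> * g"
  using assms unfolding ideal2_def by blast

lemma ideal2_commute:
  fixes f g :: "'k::field fps2"
  shows "ideal2 f g = ideal2 g f"
proof -
  have "ideal2 f g \<subseteq> ideal2 g f" for f g :: "'k fps2"
  proof
    fix s assume "s \<in> ideal2 f g"
    then obtain \<alpha> \<beta> where "s = \<alpha> * f + \<beta> * g" by (rule ideal2E)
    then show "s \<in> ideal2 g f" by (intro ideal2I[of s \<beta> g \<alpha> f]) (simp add: add.commute)
  qed
  then show ?thesis by blast
qed

lemma ideal2_zero: "0 \<in> ideal2 f g"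
  by (rule ideal2I[of _ 0 _ 0]) simp

lemma ideal2_add: assumes "s \<in> ideal2 f g" "t \<in> ideal2 f g" shows "s + t \<in> ideal2 f g"
proof -
  obtain \<alpha> \<beta> where s: "s = \<alpha> * f + \<beta> * g" using assms(1) by (rule ideal2E)
  obtain \<gamma> \<delta> where t: "t = \<gamma> * f + \<delta> * g" using assms(2) by (rule ideal2E)
  show ?thesis unfolding s t by (rule ideal2I[of _ "\<alpha> + \<gamma>" _ "\<beta> + \<delta>"]) (simp add: algebra_simps)
qed

lemma ideal2_mult: assumes "s \<in> ideal2 f g" shows "r * s \<in> ideal2 f g"
proof -
  obtain \<alpha> \<beta> where s: "s = \<alpha> * f + \<beta> * g" using assms by (rule ideal2E)
  show ?thesis unfolding s by (rule ideal2I[of _ "r * \<alpha>" _ "r * \<beta>"]) (simp add: algebra_simps)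
qed

lemma ideal2_sum: "(\<And>i. i \<in> I \<Longrightarrow> h i \<in> ideal2 f g) \<Longrightarrow> sum h I \<in> ideal2 f g"
  by (induction I rule: infinite_finite_induct) (auto intro: ideal2_zero ideal2_add)

text \<open>
  The family \<open>b\<close> induces a basis of the quotient vector space \<open>k[[x,y]]/J\<close>; the colength of \<open>J\<close> is the
  number of its members, by \<open>basis_modulo_card_le\<close>.
\<close>
definition basis_modulo :: "'k::field fps2 set \<Rightarrow> 'i set \<Rightarrow> ('i \<Rightarrow> 'k fps2) \<Rightarrow> bool" where
  "basis_modulo J I b \<longleftrightarrow> finite I \<and>
     (\<forall>s. \<exists>c. s - (\<Sum>i\<in>I. scalar (c i) * b i) \<in> J) \<and>
     (\<forall>c. (\<Sum>i\<in>I. scalar (c i) * b i) \<in> J \<longrightarrow> (\<forall>i\<in>I. c i = 0))"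

lemma basis_modulo_card_le:
  assumes a: "basis_modulo (ideal2 f g) I a" and b: "basis_modulo (ideal2 f g) L b"
  shows "card I \<le> card L"
proof (rule ccontr)
  assume "\<not> card I \<le> card L"
  then have less: "card L < card I" by simp
  have fin: "finite I" "finite L" using a b unfolding basis_modulo_def by auto
  have "\<forall>i. \<exists>m. a i - (\<Sum>j\<in>L. scalar (m j) * b j) \<in> ideal2 f g"
    using b unfolding basis_modulo_def by blast
  then obtain m where m: "\<forall>i. a i - (\<Sum>j\<in>L. scalar (m i j) * b j) \<in> ideal2 f g" by metis
  obtain c where c: "\<exists>i\<in>I. c i \<noteq> 0" "\<forall>j\<in>L. (\<Sum>i\<in>I. c i * m i j) = 0"
    using homogeneous_system_nontrivial[OF fin(2,1) less, of m] by blast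
  have "(\<Sum>i\<in>I. scalar (c i) * (\<Sum>j\<in>L. scalar (m i j) * b j))
      = (\<Sum>i\<in>I. \<Sum>j\<in>L. scalar (c i * m i j) * b j)"
    by (simp only: sum_distrib_left scalar_mult mult.assoc)
  also have "\<dots> = (\<Sum>j\<in>L. scalar (\<Sum>i\<in>I. c i * m i j) * b j)"
    by (subst sum.swap) (simp only: scalar_sum sum_distrib_right)
  also have "\<dots> = 0" using c(2) by simp
  finally have zero: "(\<Sum>i\<in>I. scalar (c i) * (\<Sum>j\<in>L. scalar (m i j) * b j)) = 0" .
  have "(\<Sum>i\<in>I. scalar (c i) * a i)
      = (\<Sum>i\<in>I. scalar (c i) * (a i - (\<Sum>j\<in>L. scalar (m i j) * b j)))"
    using zero by (simp only: right_diff_distrib sum_subtractf) simp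
  also have "\<dots> \<in> ideal2 f g" by (intro ideal2_sum ideal2_mult m[rule_format])
  finally have "\<forall>i\<in>I. c i = 0" using a unfolding basis_modulo_def by blast
  then show False using c(1) by blast
qed

context branch_valuation
begin

lemma w_zero: "w 0 = \<infinity>" using infinite_iff by simp

lemma not_unit: "\<not> f dvd 1"
proof
  assume "f dvd 1"
  obtain a where "w a = enat C" using attained by blast
  moreover have "f dvd a" using \<open>f dvd 1\<close> dvd_trans one_dvd by blast
  ultimately show False using infinite_iff[of a] by simp
qed

lemma w_one: "w 1 = 0"
proof -
  have "w 1 + w 1 = w 1" using mult[of 1 1] by simp
  moreover have "w 1 \<noteq> \<infinity>" using not_unit infinite_iff by simp
  ultimately show ?thesis by (cases "w 1") (auto simp: zero_enat_def)
qed

lemma w_unit: assumes "u dvd 1" shows "w u = 0"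
proof -
  obtain v where "1 = u * v" using assms by (rule dvdE)
  then have "w u + w v = 0" using mult[of u v] w_one by simp
  then show ?thesis by simp
qed

lemma w_scalar: "c \<noteq> 0 \<Longrightarrow> w (scalar c) = 0"
  using w_unit scalar_dvd_1 by blast

lemma w_uminus: "w (- a) = w a"
  using mult[of "- 1" a] w_unit[of "- 1"] by simp

lemma ge_add: "enat n \<le> w a \<Longrightarrow> enat n \<le> w b \<Longrightarrow> enat n \<le> w (a + b)"
  using add[of a b] by (meson min.boundedI order_trans)

lemma ge_diff: "enat n \<le> w a \<Longrightarrow> enat n \<le> w b \<Longrightarrow> enat n \<le> w (a - b)"
  using ge_add[of n a "- b"] w_uminus by simp

lemma ge_mult: "enat m \<le> w a \<Longrightarrow> enat n \<le> w b \<Longrightarrow> enat (m + n) \<le> w (a * b)"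
  unfolding mult plus_enat_simps(1)[symmetric] by (rule add_mono)

lemma ge_mult_left: assumes "enat n \<le> w b" shows "enat n \<le> w (a * b)"
  using ge_mult[of 0 a n b] assms by (simp flip: zero_enat_def)

lemma ge_sum: "(\<And>i. i \<in> I \<Longrightarrow> enat n \<le> w (h i)) \<Longrightarrow> enat n \<le> w (sum h I)"
  by (induction I rule: infinite_finite_induct) (auto simp: w_zero intro: ge_add)

lemma w_add_eq: assumes "w a < w b" shows "w (a + b) = w a"
proof (rule antisym)
  show "w a \<le> w (a + b)" using add[of a b] assms by (simp add: min_absorb1)
  show "w (a + b) \<le> w a"
  proof (rule ccontr)
    assume "\<not> ?thesis"
    then have "w a < min (w (a + b)) (w (- b))" using assms w_uminus by simp
    also have "\<dots> \<le> w (a + b + - b)" by (rule add)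
    finally show False by simp
  qed
qed

lemma w_diff_eq: assumes "w b < w (a - b)" shows "w a = w b"
  using w_add_eq[OF assms] by simp

lemma w_power: "w a = enat n \<Longrightarrow> w (a ^ k) = enat (k * n)"
  by (induction k) (simp_all add: w_one mult zero_enat_def)

lemma all_ge_imp_dvd: assumes "\<And>n. enat n \<le> w a" shows "f dvd a"
proof -
  have "w a = \<infinity>"
  proof (cases "w a")
    case (enat k)
    then show ?thesis using assms[of "Suc k"] by simp
  qed simp
  then show ?thesis using infinite_iff by simp
qed

text \<open>
  The value semigroup of the branch.
\<close>
definition value_set :: "nat set" where "value_set = {n. \<exists>a. w a = enat n}"

text \<open>
  Let \<open>\<Gamma>\<close> be the value semigroup and \<open>\<Delta>\<close> the complement of \<open>\<Gamma> + m\<close> in \<open>\<Gamma>\<close>. The members of \<open>\<Gamma>\<close>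
  below \<open>C + m\<close> split into \<open>\<Delta>\<close> and the shift by \<open>m\<close> of those below \<open>C\<close>, and also into those below
  \<open>C\<close> and the \<open>m\<close> numbers from \<open>C\<close> on.
\<close>
lemma gap_count:
  assumes closed: "\<And>n. n \<in> value_set \<Longrightarrow> n + m \<in> value_set"
  defines "\<Delta> \<equiv> {n \<in> value_set. \<forall>l\<in>value_set. n \<noteq> l + m}"
  shows "finite \<Delta>" "card \<Delta> = m"
proof -
  have big: "n \<in> value_set" if "C \<le> n" for n
    using attained[OF that] unfolding value_set_def by blast
  have \<Delta>_less: "n < C + m" if "n \<in> \<Delta>" for n
  proof (rule ccontr)
    assume "\<not> n < C + m"
    then have "n - m \<in> value_set" "n = (n - m) + m" using big[of "n - m"] by auto
    then show False using that unfolding \<Delta>_def by blast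
  qed
  then have "\<Delta> \<subseteq> {..<C + m}" by blast
  then show fin: "finite \<Delta>" using finite_subset by blast
  define low where "low = {n \<in> value_set. n < C}"
  have low: "finite low" unfolding low_def by simp
  have "\<Delta> \<union> (\<lambda>n. n + m) ` low = low \<union> {C..<C + m}"
  proof (intro equalityI subsetI)
    fix n assume "n \<in> \<Delta> \<union> (\<lambda>n. n + m) ` low"
    then have "n \<in> value_set \<and> n < C + m"
    proof
      assume "n \<in> \<Delta>"
      then show ?thesis using \<Delta>_less[of n] unfolding \<Delta>_def by blast
    next
      assume "n \<in> (\<lambda>n. n + m) ` low"
      then obtain l where "l \<in> low" "n = l + m" by blast
      then show ?thesis using closed[of l] unfolding low_def by simp
    qed
    then show "n \<in> low \<union> {C..<C + m}" unfolding low_def by simp linarith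
  next
    fix n assume "n \<in> low \<union> {C..<C + m}"
    then have n: "n \<in> value_set" "n < C + m" using big unfolding low_def by auto
    show "n \<in> \<Delta> \<union> (\<lambda>n. n + m) ` low"
    proof (cases "n \<in> \<Delta>")
      case False
      then obtain l where "l \<in> value_set" "n = l + m" using n unfolding \<Delta>_def by blast
      then show ?thesis using n unfolding low_def by auto
    qed simp
  qed
  moreover have "card (\<Delta> \<union> (\<lambda>n. n + m) ` low) = card \<Delta> + card low"
    using fin low by (subst card_Un_disjoint) (auto simp: \<Delta>_def low_def card_image)
  moreover have "card (low \<union> {C..<C + m}) = card low + m"
    using low by (subst card_Un_disjoint) (auto simp: low_def)
  ultimately show "card \<Delta> = m" by simp
qed

text \<open>
  For each value that is attained on \<open>k[[x,y]]\<close> but not on the multiples of \<open>g\<close>, choose one series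
  of that value; there are \<open>m\<close> such values by \<open>gap_count\<close>. A nontrivial combination of these series
  has one of these values, so it is not in the ideal. Conversely any series can be corrected
  by such combinations and by multiples of \<open>g\<close> until its value reaches \<open>m + C\<close>, where it is a multiple
  of \<open>g\<close> modulo \<open>f\<close>.
\<close>
lemma valuation_eq_colength:
  assumes wg: "w g = enat m"
  shows "\<exists>(\<Delta> :: nat set) b. basis_modulo (ideal2 f g) \<Delta> b \<and> card \<Delta> = m"
proof -
  define \<Delta> where "\<Delta> = {n \<in> value_set. \<forall>l\<in>value_set. n \<noteq> l + m}"
  have closed: "n + m \<in> value_set" if n: "n \<in> value_set" for n
  proof -
    obtain a where "w a = enat n" using n unfolding value_set_def by blast
    then have "w (a * g) = enat (n + m)" using mult wg by simp
    then show ?thesis unfolding value_set_def by blast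
  qed
  have fin: "finite \<Delta>" and card: "card \<Delta> = m"
    using gap_count[OF closed] unfolding \<Delta>_def by auto
  have "\<forall>n. \<exists>a. n \<in> \<Delta> \<longrightarrow> w a = enat n" unfolding \<Delta>_def value_set_def by blast
  then obtain b where b: "\<And>n. n \<in> \<Delta> \<Longrightarrow> w (b n) = enat n" by metis
  have indep: "\<forall>i\<in>\<Delta>. c i = 0" if c: "(\<Sum>i\<in>\<Delta>. scalar (c i) * b i) \<in> ideal2 f g" for c
  proof (rule ccontr)
    assume not_zero: "\<not> (\<forall>i\<in>\<Delta>. c i = 0)"
    define N where "N = {i \<in> \<Delta>. c i \<noteq> 0}"
    have N: "finite N" "N \<noteq> {}" using fin not_zero unfolding N_def by auto
    define n where "n = Min N"
    have n: "n \<in> N" unfolding n_def using N by (rule Min_in)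
    then have n\<Delta>: "n \<in> \<Delta>" "c n \<noteq> 0" unfolding N_def by auto
    have "(\<Sum>i\<in>\<Delta>. scalar (c i) * b i) = (\<Sum>i\<in>N. scalar (c i) * b i)"
      using fin unfolding N_def by (intro sum.mono_neutral_right) auto
    also have "\<dots> = scalar (c n) * b n + (\<Sum>i\<in>N - {n}. scalar (c i) * b i)"
      using N(1) n by (rule sum.remove)
    finally have eq: "(\<Sum>i\<in>\<Delta>. scalar (c i) * b i) = scalar (c n) * b n + (\<Sum>i\<in>N - {n}. scalar (c i) * b i)" .
    have "enat (Suc n) \<le> w (\<Sum>i\<in>N - {n}. scalar (c i) * b i)"
    proof (intro ge_sum ge_mult_left)
      fix i assume i: "i \<in> N - {n}"
      then have "n < i" using Min_le[OF N(1), of i] unfolding n_def by auto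
      moreover have "w (b i) = enat i" using b i unfolding N_def by blast
      ultimately show "enat (Suc n) \<le> w (b i)" by simp
    qed
    moreover have wn: "w (scalar (c n) * b n) = enat n" using mult w_scalar b n\<Delta> by simp
    ultimately have "w (scalar (c n) * b n) < w (\<Sum>i\<in>N - {n}. scalar (c i) * b i)"
      by (simp add: Suc_ile_eq)
    then have val: "w (\<Sum>i\<in>\<Delta>. scalar (c i) * b i) = enat n" unfolding eq using w_add_eq wn by simp
    obtain \<alpha> \<beta> where ab: "(\<Sum>i\<in>\<Delta>. scalar (c i) * b i) = \<alpha> * f + \<beta> * g" using c by (rule ideal2E)
    have inf: "w (\<alpha> * f) = \<infinity>" using infinite_iff by simp
    have "w (\<beta> * g) = enat n"
    proof (rule ccontr)
      assume "w (\<beta> * g) \<noteq> enat n"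
      then show False
      proof (cases "w (\<beta> * g) = \<infinity>")
        case True
        then have "f dvd \<alpha> * f + \<beta> * g" using infinite_iff by simp
        then show False using val ab infinite_iff by (metis enat.distinct(1))
      next
        case False
        then have "w (\<beta> * g + \<alpha> * f) = w (\<beta> * g)" using inf by (intro w_add_eq) simp
        then show False using val ab \<open>w (\<beta> * g) \<noteq> enat n\<close> by (simp add: add.commute)
      qed
    qed
    then obtain l where "w \<beta> = enat l" "n = l + m" unfolding mult wg by (cases "w \<beta>") auto
    then show False using n\<Delta>(1) unfolding \<Delta>_def value_set_def by blast
  qed
  have span: "\<exists>c. s - (\<Sum>i\<in>\<Delta>. scalar (c i) * b i) \<in> ideal2 f g" for s
  proof -
    have "\<exists>c. \<exists>r\<in>ideal2 f g. enat n \<le> w (s - (\<Sum>i\<in>\<Delta>. scalar (c i) * b i) - r)" for n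
    proof (induction n)
      case 0
      then show ?case using ideal2_zero by (auto simp flip: zero_enat_def)
    next
      case (Suc n)
      then obtain c r where r: "r \<in> ideal2 f g"
        and n: "enat n \<le> w (s - (\<Sum>i\<in>\<Delta>. scalar (c i) * b i) - r)" by blast
      define s' where "s' = s - (\<Sum>i\<in>\<Delta>. scalar (c i) * b i) - r"
      show ?case
      proof (cases "w s' = enat n")
        case False
        then have "enat (Suc n) \<le> w s'" using n unfolding s'_def by (simp add: Suc_ile_eq)
        then show ?thesis using r unfolding s'_def by blast
      next
        case True
        show ?thesis
        proof (cases "n \<in> \<Delta>")
          case n\<Delta>: True
          obtain d where d: "w s' < w (s' - scalar d * b n)"
            using residue[of s' "b n"] True b[OF n\<Delta>] by auto
          define c' where "c' i = c i + (if i = n then d else 0)" for i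
          have "(\<Sum>i\<in>\<Delta>. scalar (c' i) * b i)
              = (\<Sum>i\<in>\<Delta>. scalar (c i) * b i) + (\<Sum>i\<in>\<Delta>. if i = n then scalar d * b i else 0)"
            unfolding sum.distrib[symmetric]
            by (intro sum.cong refl) (simp add: c'_def scalar_add distrib_right)
          also have "(\<Sum>i\<in>\<Delta>. if i = n then scalar d * b i else 0) = scalar d * b n"
            using fin n\<Delta> by (simp add: sum.delta)
          finally have "s - (\<Sum>i\<in>\<Delta>. scalar (c' i) * b i) - r = s' - scalar d * b n"
            unfolding s'_def by simp
          then have "enat (Suc n) \<le> w (s - (\<Sum>i\<in>\<Delta>. scalar (c' i) * b i) - r)"
            using d True by (simp add: Suc_ile_eq)
          then show ?thesis using r by blast
        next
          case n\<Delta>: False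
          moreover have "n \<in> value_set" using True unfolding value_set_def by blast
          ultimately obtain l \<beta> where l: "n = l + m" "w \<beta> = enat l"
            unfolding \<Delta>_def value_set_def by blast
          then have "w (\<beta> * g) = w s'" using mult wg True by simp
          then obtain d where d: "w s' < w (s' - scalar d * (\<beta> * g))"
            using residue[of s' "\<beta> * g"] True by auto
          have "scalar d * (\<beta> * g) \<in> ideal2 f g"
            by (rule ideal2I[of _ 0 _ "scalar d * \<beta>"]) (simp add: mult.assoc)
          then have "r + scalar d * (\<beta> * g) \<in> ideal2 f g" using r ideal2_add by blast
          moreover have "enat (Suc n) \<le> w (s - (\<Sum>i\<in>\<Delta>. scalar (c i) * b i) - (r + scalar d * (\<beta> * g)))"
            using d True unfolding s'_def by (simp add: Suc_ile_eq diff_diff_add add.assoc)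
          ultimately show ?thesis by blast
        qed
      qed
    qed
    from this[of "m + C"] obtain c r where r: "r \<in> ideal2 f g"
      and ge: "enat (m + C) \<le> w (s - (\<Sum>i\<in>\<Delta>. scalar (c i) * b i) - r)" by blast
    then obtain t where "f dvd s - (\<Sum>i\<in>\<Delta>. scalar (c i) * b i) - r - t * g"
      using conductor[of g] wg by (auto simp flip: plus_enat_simps(1))
    then obtain \<alpha> where "s - (\<Sum>i\<in>\<Delta>. scalar (c i) * b i) - r - t * g = f * \<alpha>" by (rule dvdE)
    then have "s - (\<Sum>i\<in>\<Delta>. scalar (c i) * b i) = r + (\<alpha> * f + t * g)" by (simp add: algebra_simps)
    then have "s - (\<Sum>i\<in>\<Delta>. scalar (c i) * b i) \<in> ideal2 f g"
      using ideal2_add[OF r ideal2I[OF refl]] by metis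
    then show ?thesis by blast
  qed
  have "basis_modulo (ideal2 f g) \<Delta> b"
    unfolding basis_modulo_def using fin span indep by blast
  then show ?thesis using card by blast
qed

end

section \<open>Extraction of roots\<close>

lemma power_diff_dvd: "a - b dvd a ^ n - b ^ n" for a b :: "'a::comm_ring_1"
proof (induction n)
  case (Suc n)
  have "a ^ Suc n - b ^ Suc n = a * (a ^ n - b ^ n) + (a - b) * b ^ n" by (simp add: algebra_simps)
  then show ?case using Suc by (metis dvd_add dvd_mult dvd_triv_left)
qed simp

context branch_valuation
begin

text \<open>
  The binomial expansion to first order: the remaining terms contain \<open>z\<^sup>2\<close>.
\<close>
lemma power_expansion:
  assumes a: "w a = enat A" and z: "enat (A + j) \<le> w z"
  shows "enat (n * A + 2 * j) \<le> w ((a + z) ^ n - a ^ n - of_nat n * a ^ (n - 1) * z)"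
proof (induction n)
  case 0
  then show ?case using w_zero by simp
next
  case (Suc n)
  have eq: "(a + z) ^ Suc n - a ^ Suc n - of_nat (Suc n) * a ^ (Suc n - 1) * z
      = ((a + z) ^ n - a ^ n - of_nat n * a ^ (n - 1) * z) * (a + z)
        + of_nat n * (a ^ (n - 1) * (z * z))"
    by (cases n) (simp_all add: algebra_simps)
  have "enat A \<le> w (a + z)" using a z by (intro ge_add) (auto intro: order_trans[rotated])
  then have 1: "enat (n * A + 2 * j + A) \<le> w (((a + z) ^ n - a ^ n - of_nat n * a ^ (n - 1) * z) * (a + z))"
    by (rule ge_mult[OF Suc.IH])
  have 2: "enat (n * A + 2 * j + A) \<le> w (of_nat n * (a ^ (n - 1) * (z * z)))"
  proof (cases n)
    case 0
    then show ?thesis using w_zero by simp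
  next
    case (Suc k)
    have "enat (k * A + ((A + j) + (A + j))) \<le> w (a ^ k * (z * z))"
      by (intro ge_mult z) (simp add: w_power[OF a])
    then have "enat (k * A + ((A + j) + (A + j))) \<le> w (of_nat (Suc k) * (a ^ k * (z * z)))"
      by (rule ge_mult_left)
    also have "k * A + ((A + j) + (A + j)) = n * A + 2 * j + A" unfolding Suc by simp
    finally show ?thesis unfolding Suc by simp
  qed
  from ge_add[OF 1 2] show ?case unfolding eq by (simp add: algebra_simps)
qed

text \<open>
  A Newton step. The linear term \<open>q a ^ (q - 1) z\<close> has value \<open>q A + j\<close> when \<open>z\<close> has value \<open>A + j\<close>,
  since \<open>q\<close> is a unit, and the terms of higher order have larger value. So a suitable scalar multiple
  of any \<open>z\<close> of value \<open>A + j\<close> cancels the leading part of the error. Above the conductor,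
  \<open>z\<close> can be taken divisible by a prescribed power of \<open>T\<close>, which makes the corrections summable
  in \<open>k[[x,y]]\<close>.
\<close>
lemma improve_root:
  assumes q: "of_nat q \<noteq> (0 :: 'k)" and T: "w T = enat \<omega>"
    and a: "w a = enat A" and j: "0 < j" and ge: "enat (q * A + j) \<le> w (G - a ^ q)"
    and room: "i * \<omega> + C \<le> A + j"
  shows "\<exists>z. T ^ i dvd z \<and> w (a + z) = enat A \<and> enat (q * A + Suc j) \<le> w (G - (a + z) ^ q)"
proof (cases "w (G - a ^ q) = enat (q * A + j)")
  case False
  then have "enat (q * A + Suc j) \<le> w (G - a ^ q)" using ge by (simp add: Suc_ile_eq)
  then show ?thesis using a by (intro exI[of _ 0]) simp
next
  case True
  have q0: "q \<noteq> 0" using q by (cases q) auto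
  obtain y where y: "w y = enat (A + j - i * \<omega>)" using attained[of "A + j - i * \<omega>"] room by force
  have z0: "w (T ^ i * y) = enat (A + j)" using mult w_power[OF T] y room by simp
  have "of_nat n = scalar (of_nat n :: 'k)" for n
    by (induction n) (simp_all add: scalar_add)
  then have "w (of_nat q) = 0" using w_scalar[OF q] by metis
  then have "w (of_nat q * a ^ (q - 1) * (T ^ i * y)) = enat (0 + (q - 1) * A + (A + j))"
    unfolding mult[of "_ * _"] z0 mult[of "of_nat q"] w_power[OF a] by simp
  also have "0 + (q - 1) * A + (A + j) = q * A + j" using q0 by (cases q) auto
  finally have "w (of_nat q * a ^ (q - 1) * (T ^ i * y)) = w (G - a ^ q)" using True by simp
  then obtain c where "w (G - a ^ q) < w (G - a ^ q - scalar c * (of_nat q * a ^ (q - 1) * (T ^ i * y)))"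
    using residue[of "G - a ^ q"] True by (metis enat.distinct(1))
  then have c: "enat (q * A + Suc j) \<le> w (G - a ^ q - scalar c * (of_nat q * a ^ (q - 1) * (T ^ i * y)))"
    unfolding True by (simp add: Suc_ile_eq)
  define z where "z = scalar c * (T ^ i * y)"
  have z: "enat (A + j) \<le> w z" unfolding z_def by (rule ge_mult_left) (simp add: z0)
  have "enat (q * A + 2 * j) \<le> w ((a + z) ^ q - a ^ q - of_nat q * a ^ (q - 1) * z)"
    by (rule power_expansion[OF a z])
  moreover have "enat (q * A + Suc j) \<le> enat (q * A + 2 * j)" using j by simp
  ultimately have "enat (q * A + Suc j) \<le> w ((a + z) ^ q - a ^ q - of_nat q * a ^ (q - 1) * z)"
    by (rule order_trans[rotated])
  from ge_diff[OF c this] have "enat (q * A + Suc j) \<le> w (G - (a + z) ^ q)"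
    unfolding z_def by (simp add: mult_ac)
  moreover have "w (a + z) = enat A"
  proof -
    have "w a < w z" using z j unfolding a by (cases "w z") auto
    then show ?thesis using w_add_eq a by simp
  qed
  moreover have "T ^ i dvd z" unfolding z_def by (simp add: mult.left_commute)
  ultimately show ?thesis by blast
qed

lemma improve_root_block:
  assumes "of_nat q \<noteq> (0 :: 'k)" "w T = enat \<omega>" "i * \<omega> + C \<le> A + j"
    and "w a = enat A" "0 < j" "enat (q * A + j) \<le> w (G - a ^ q)"
  shows "\<exists>z. T ^ i dvd z \<and> w (a + z) = enat A \<and> enat (q * A + (j + t)) \<le> w (G - (a + z) ^ q)"
proof (induction t)
  case 0
  then show ?case using assms by (intro exI[of _ 0]) simp
next
  case (Suc t)
  then obtain z where z: "T ^ i dvd z" "w (a + z) = enat A" "enat (q * A + (j + t)) \<le> w (G - (a + z) ^ q)"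
    by blast
  obtain y where "T ^ i dvd y" "w (a + z + y) = enat A" "enat (q * A + Suc (j + t)) \<le> w (G - (a + z + y) ^ q)"
    using improve_root[OF assms(1,2) z(2) _ z(3), of i] assms(3,5) by auto
  then show ?case using z(1) by (intro exI[of _ "z + y"]) (simp add: add.assoc)
qed

text \<open>
  Multiplying \<open>g\<close> by the \<open>q\<close>th power of an element \<open>b\<close> of value \<open>C\<close> moves the sought root above the
  conductor, where every value is attained and the approximation can be carried out in \<open>k[[x,y]]\<close>.
  The initial approximation matches leading coefficients, using a \<open>q\<close>th root in \<open>k\<close>; after that
  each block of \<open>\<omega>\<close> steps of \<open>improve_root\<close> allows one more factor \<open>T\<close> in the corrections.
\<close>
lemma root_exists:
  assumes q: "of_nat q \<noteq> (0 :: 'k)"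
    and T: "w T = enat \<omega>" "0 < \<omega>" "adically_complete T"
    and g: "w g = enat (q * m)"
  shows "\<exists>a b. \<not> f dvd b \<and> f dvd a ^ q - g * b ^ q"
proof -
  have q0: "0 < q" using q by (cases q) auto
  obtain b where b: "w b = enat C" using attained by blast
  define A where "A = C + m"
  define G where "G = g * b ^ q"
  have G: "w G = enat (q * A)" unfolding G_def A_def mult g w_power[OF b] by (simp add: algebra_simps)
  obtain e where e: "w e = enat A" using attained[of A] unfolding A_def by auto
  obtain c where c: "w G < w (G - scalar c * e ^ q)"
    using residue[of G "e ^ q"] G w_power[OF e] by auto
  obtain d where d: "d ^ q = c" using nth_root_exists[OF q0] by blast
  define a0 where "a0 = scalar d * e"
  have "w G < w (G - a0 ^ q)" using c unfolding a0_def power_mult_distrib scalar_power[symmetric] d .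
  then have a0_ge: "enat (q * A + 1) \<le> w (G - a0 ^ q)" unfolding G by (simp add: Suc_ile_eq)
  have "c \<noteq> 0" using c by auto
  then have "d \<noteq> 0" using d q0 by auto
  then have a0: "w a0 = enat A" unfolding a0_def mult w_scalar[OF \<open>d \<noteq> 0\<close>] e by simp
  define good where "good i a \<longleftrightarrow> w a = enat A \<and> enat (q * A + (1 + i * \<omega>)) \<le> w (G - a ^ q)" for i a
  have "\<exists>s. \<forall>i. good i (s i) \<and> T ^ i dvd s (Suc i) - s i"
  proof (rule dependent_nat_choice)
    show "\<exists>a. good 0 a" unfolding good_def using a0 a0_ge by (intro exI[of _ a0]) simp
  next
    fix a i assume "good i a"
    then have "w a = enat A" "enat (q * A + (1 + i * \<omega>)) \<le> w (G - a ^ q)" unfolding good_def by auto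
    then obtain z where "T ^ i dvd z" "w (a + z) = enat A"
        "enat (q * A + (1 + i * \<omega> + \<omega>)) \<le> w (G - (a + z) ^ q)"
      using improve_root_block[OF q T(1), of i A "1 + i * \<omega>" a G \<omega>] unfolding A_def by auto
    then show "\<exists>a'. good (Suc i) a' \<and> T ^ i dvd a' - a"
      unfolding good_def by (intro exI[of _ "a + z"]) (simp add: algebra_simps)
  qed
  then obtain s where s: "\<And>i. good i (s i)" "\<And>i. T ^ i dvd s (Suc i) - s i" by blast
  have "\<forall>i. \<exists>d. s (Suc i) - s i = T ^ i * d" using s(2) by (simp add: dvd_def)
  then obtain d where d: "\<And>i. s (Suc i) - s i = T ^ i * d i" by metis
  obtain l where l: "\<And>n. T ^ n dvd l - (\<Sum>i<n. T ^ i * d i)"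
    using T(3) unfolding adically_complete_def by blast
  have tele: "(\<Sum>i<n. T ^ i * d i) = s n - s 0" for n
    unfolding d[symmetric] by (rule sum_lessThan_telescope)
  define r where "r = l + s 0"
  have "f dvd G - r ^ q"
  proof (rule all_ge_imp_dvd)
    fix n
    have "T ^ n dvd r - s n" using l[of n] unfolding tele r_def by (simp add: algebra_simps)
    then have "T ^ n dvd r ^ q - s n ^ q" using power_diff_dvd dvd_trans by blast
    then obtain y where y: "r ^ q - s n ^ q = y * T ^ n" by (metis dvdE mult.commute)
    have n1: "n \<le> n * \<omega>" using T(2) by simp
    then have "n \<le> q * A + (1 + n * \<omega>)" by linarith
    note n = n1 this
    have "enat n \<le> w (r ^ q - s n ^ q)"
      unfolding y by (rule ge_mult_left) (use n in \<open>simp add: w_power[OF T(1)]\<close>)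
    moreover have "enat n \<le> w (G - s n ^ q)"
    proof -
      have "enat n \<le> enat (q * A + (1 + n * \<omega>))" using n by (simp del: One_nat_def)
      then show ?thesis using s(1)[of n] unfolding good_def by (meson order_trans)
    qed
    ultimately have "enat n \<le> w (G - s n ^ q - (r ^ q - s n ^ q))" by (rule ge_diff[rotated])
    then show "enat n \<le> w (G - r ^ q)" by simp
  qed
  then have "f dvd r ^ q - g * b ^ q" unfolding G_def by (metis dvd_minus_iff minus_diff_eq)
  moreover have "\<not> f dvd b" using b infinite_iff by (metis enat.distinct(1))
  ultimately show ?thesis by blast
qed

text \<open>
  Either \<open>x\<close> or \<open>y\<close> is not a multiple of \<open>f\<close>. It has positive value: an element of value 0 differs
  from some nonzero scalar by an element of positive value, but here that difference is a unit.
\<close>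
lemma parameter_exists: "\<exists>T \<omega>. w T = enat \<omega> \<and> 0 < \<omega> \<and> adically_complete T"
proof -
  have pos: "\<exists>\<omega>. w T = enat \<omega> \<and> 0 < \<omega>" if T: "T $ 0 $ 0 = 0" "\<not> f dvd T" for T
  proof -
    obtain \<omega> where \<omega>: "w T = enat \<omega>" using T(2) infinite_iff by (cases "w T") auto
    have "\<omega> \<noteq> 0"
    proof
      assume "\<omega> = 0"
      then have "w T = w 1" "w T = 0" using \<omega> w_one by (simp_all add: zero_enat_def)
      then obtain c where c: "0 < w (T - scalar c * 1)" using residue[of T 1] by auto
      show False
      proof (cases "c = 0")
        case True
        then show False using c \<open>w T = 0\<close> by simp
      next
        case False
        then have "w (T - scalar c * 1) = 0"
          using T(1) by (intro w_unit) (simp add: is_unit_fps2_iff scalar_def)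
        then show False using c by simp
      qed
    qed
    then show ?thesis using \<omega> by blast
  qed
  have "\<not> f dvd xvar \<or> \<not> f dvd yvar"
  proof (rule ccontr)
    assume "\<not> ?thesis"
    then obtain a b where a: "xvar = f * a" and b: "yvar = f * b" by (auto elim!: dvdE)
    have "xvar dvd f \<or> xvar dvd a" using xvar_dvd_mult_iff a by (metis dvd_refl)
    then show False
    proof
      assume "xvar dvd f"
      then have "xvar dvd (yvar :: 'k fps2)" unfolding b by (rule dvd_mult2)
      then have "(yvar :: 'k fps2) $ 1 $ 0 = 0" unfolding xvar_dvd_iff by blast
      then show False by simp
    next
      assume "xvar dvd a"
      then obtain a' where "a = xvar * a'" by (rule dvdE)
      then have "xvar * 1 = xvar * (f * a')" using a by (simp add: mult_ac)
      then have "1 = f * a'" using mult_left_cancel[OF xvar_nonzero] by blast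
      then show False using not_unit by (metis dvdI)
    qed
  qed
  then show ?thesis
  proof
    assume "\<not> f dvd xvar"
    then show ?thesis using pos[of xvar] adically_complete_xvar by (auto simp: xvar_def)
  next
    assume "\<not> f dvd yvar"
    then show ?thesis using pos[of yvar] adically_complete_yvar by auto
  qed
qed

end

text \<open>
  Both numbers are the colength of the ideal generated by \<open>f\<close> and \<open>g\<close>.
\<close>
theorem intersection_number_symmetric:
  assumes "branch_valuation f w C" "branch_valuation g w' C'" "w g = enat m" "w' f = enat m'"
  shows "m = m'"
proof -
  obtain \<Delta> \<Delta>' :: "nat set" and b b' where
    1: "basis_modulo (ideal2 f g) \<Delta> b" "card \<Delta> = m" and
    2: "basis_modulo (ideal2 g f) \<Delta>' b'" "card \<Delta>' = m'"
    using branch_valuation.valuation_eq_colength[OF assms(1,3)]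
      branch_valuation.valuation_eq_colength[OF assms(2,4)] by blast
  note 3 = 2(1)[unfolded ideal2_commute[of g f]]
  show ?thesis
    using basis_modulo_card_le[OF 1(1) 3] basis_modulo_card_le[OF 3 1(1)] 1(2) 2(2) by simp
qed

text \<open>
  Congruent elements modulo \<open>g\<close> have the same value on the branch \<open>g = 0\<close>, so the intersection
  number of \<open>f\<close> and \<open>g\<close> is \<open>q\<close> times the value of \<open>h\<close>. Read on the branch \<open>f = 0\<close>, this says that
  the value of \<open>g\<close> is divisible by \<open>q\<close>. If \<open>f\<close> divides \<open>g\<close>, the residue of \<open>g\<close> is \<open>0 ^ q\<close>.
\<close>
theorem power_reciprocity:
  fixes f g :: "'k::alg_closed_field fps2"
  assumes q: "of_nat q \<noteq> (0 :: 'k)" and f: "Factorial_Ring.irreducible f"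
    and g: "Factorial_Ring.irreducible g" and pm: "power_mod q f g"
  shows "\<exists>a b. \<not> f dvd b \<and> f dvd a ^ q - g * b ^ q"
proof -
  have q0: "q \<noteq> 0" using q by (cases q) auto
  obtain w C where "branch_valuation f w C" using irreducible_has_branch_valuation[OF f] by blast
  then interpret bf: branch_valuation f w C .
  obtain w' C' where "branch_valuation g w' C'" using irreducible_has_branch_valuation[OF g] by blast
  then interpret bg: branch_valuation g w' C' .
  show ?thesis
  proof (cases "f dvd g")
    case True
    then show ?thesis using bf.not_unit q0 by (intro exI[of _ 0] exI[of _ 1]) (simp add: power_0_left)
  next
    case fg: False
    then have gf: "\<not> g dvd f" using irreducible_dvd_irreducible[OF g f] by blast
    obtain h where h: "g dvd f - h ^ q" using pm unfolding power_mod_def by blast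
    obtain m where m: "w g = enat m" using fg bf.infinite_iff by (cases "w g") auto
    obtain m' where m': "w' f = enat m'" using gf bg.infinite_iff by (cases "w' f") auto
    have "w' (f - h ^ q) = \<infinity>" using h bg.infinite_iff by blast
    have "\<not> g dvd h"
    proof
      assume "g dvd h"
      then have "g dvd h ^ q" using q0 by (simp add: dvd_power_iff dvd_trans[OF _ dvd_power])
      then show False using h gf by (metis dvd_add diff_add_cancel)
    qed
    then obtain n where n: "w' h = enat n" using bg.infinite_iff by (cases "w' h") auto
    have "w' f = w' (h ^ q)"
      by (rule bg.w_diff_eq) (simp add: \<open>w' (f - h ^ q) = \<infinity>\<close> bg.w_power[OF n])
    then have "m' = q * n" using m' bg.w_power[OF n] by simp
    moreover have "m = m'"
      using intersection_number_symmetric bf.branch_valuation_axioms bg.branch_valuation_axioms m m' by blast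
    ultimately have "w g = enat (q * n)" using m by simp
    then show ?thesis using bf.root_exists[OF q] bf.parameter_exists by blast
  qed
qed

section \<open>The quotient ring and its normalization\<close>

lemma fps2_ideal_iff: "a \<in> fps2_ideal f \<longleftrightarrow> f dvd a"
  by (auto simp: fps2_ideal_def cgenideal_def ring_of_type_algebra_def mult.commute elim!: dvdE)

lemma ideal_fps2_ideal: "ideal (fps2_ideal f) ring_of_type_algebra"
proof -
  interpret R: cring "ring_of_type_algebra :: 'a fps2 ring" by (rule cring_from_type_algebra)
  show ?thesis unfolding fps2_ideal_def
    by (rule R.cgenideal_ideal) (simp add: ring_of_type_algebra_def)
qed

lemma residue_class_hom: "residue_class f \<in> ring_hom ring_of_type_algebra (fps2_quotient f)"
  using ideal.rcos_ring_hom[OF ideal_fps2_ideal] unfolding residue_class_def fps2_quotient_def .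

lemma residue_class_simps:
  "residue_class f a \<in> carrier (fps2_quotient f)"
  "residue_class f (a * b) = residue_class f a \<otimes>\<^bsub>fps2_quotient f\<^esub> residue_class f b"
  "residue_class f (a + b) = residue_class f a \<oplus>\<^bsub>fps2_quotient f\<^esub> residue_class f b"
  "residue_class f 1 = \<one>\<^bsub>fps2_quotient f\<^esub>"
  using ring_hom_closed[OF residue_class_hom, of a f] ring_hom_mult[OF residue_class_hom, of a b f]
    ring_hom_add[OF residue_class_hom, of a b f] ring_hom_one[OF residue_class_hom, of f]
  by (simp_all add: ring_of_type_algebra_def)

lemma residue_class_eq_zero_iff: "residue_class f a = \<zero>\<^bsub>fps2_quotient f\<^esub> \<longleftrightarrow> f dvd a"
proof -
  interpret I: ideal "fps2_ideal f" "ring_of_type_algebra :: 'a fps2 ring" by (rule ideal_fps2_ideal)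
  have zero: "\<zero>\<^bsub>fps2_quotient f\<^esub> = fps2_ideal f"
    by (simp add: fps2_quotient_def FactRing_def)
  have carrier: "a \<in> carrier (ring_of_type_algebra :: 'a fps2 ring)"
    by (simp add: ring_of_type_algebra_def)
  show ?thesis
    using I.a_rcos_const[of a] I.a_rcos_self[OF carrier]
    unfolding zero residue_class_def fps2_ideal_iff by (metis fps2_ideal_iff)
qed

lemma domain_fps2_quotient:
  fixes f :: "'k::field fps2"
  assumes "Factorial_Ring.irreducible f"
  shows "domain (fps2_quotient f)"
proof -
  have "primeideal (fps2_ideal f) ring_of_type_algebra"
  proof (rule primeidealI[OF ideal_fps2_ideal cring_from_type_algebra])
    have "1 \<notin> fps2_ideal f"
      using assms unfolding fps2_ideal_iff Factorial_Ring.irreducible_def by blast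
    then show "carrier ring_of_type_algebra \<noteq> fps2_ideal f"
      by (auto simp: ring_of_type_algebra_def)
    show "a \<in> fps2_ideal f \<or> b \<in> fps2_ideal f" if "a \<otimes>\<^bsub>ring_of_type_algebra\<^esub> b \<in> fps2_ideal f" for a b
      using that irreducible_imp_prime_fps2[OF assms] unfolding fps2_ideal_iff
      by (simp add: ring_of_type_algebra_def)
  qed
  then show ?thesis unfolding fps2_quotient_def by (rule primeideal.quotient_is_domain)
qed

text \<open>
  The monic polynomial is \<open>X ^ n - c\<close>.
\<close>
lemma (in domain) root_integral_over:
  fixes n :: nat
  assumes z: "z \<in> carrier (fraction_field R)" and c: "c \<in> carrier R" and n: "0 < n"
    and eq: "z [^]\<^bsub>fraction_field R\<^esub> n = fraction_embed R c"
  shows "integral_over (fraction_field R) (fraction_embed R ` carrier R) z"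
proof -
  let ?K = "fraction_field R"
  interpret K: field ?K by (rule field_fraction_field)
  note hom = fraction_embed_ring_hom
  have one: "\<one>\<^bsub>?K\<^esub> = fraction_embed R \<one>" using ring_hom_one[OF hom] by simp
  have zero: "\<zero>\<^bsub>?K\<^esub> = fraction_embed R \<zero>" by (simp add: fraction_embed_def fraction_field_def)
  let ?d = "fraction_embed R (\<ominus> c)"
  have d: "?d \<in> carrier ?K" using ring_hom_closed[OF hom] c by simp
  let ?p = "K.monom \<one>\<^bsub>?K\<^esub> (n - 1) @ [?d]"
  have "K.eval ?p z = z [^]\<^bsub>?K\<^esub> (n - 1) \<otimes>\<^bsub>?K\<^esub> z \<oplus>\<^bsub>?K\<^esub> ?d"
    using K.eval_append[of "K.monom \<one>\<^bsub>?K\<^esub> (n - 1)" "[?d]" z] K.eval_monom[of "\<one>\<^bsub>?K\<^esub>" z "n - 1"] z d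
    by (simp add: K.monom_in_carrier)
  also have "z [^]\<^bsub>?K\<^esub> (n - 1) \<otimes>\<^bsub>?K\<^esub> z = z [^]\<^bsub>?K\<^esub> n"
    using n by (cases n) simp_all
  also have "z [^]\<^bsub>?K\<^esub> n \<oplus>\<^bsub>?K\<^esub> ?d = fraction_embed R (c \<oplus> \<ominus> c)"
    unfolding eq using ring_hom_add[OF hom] c by simp
  also have "\<dots> = \<zero>\<^bsub>?K\<^esub>" using c by (simp add: r_neg zero)
  finally have "K.eval ?p z = \<zero>\<^bsub>?K\<^esub>" .
  moreover have "polynomial\<^bsub>?K\<^esub> (fraction_embed R ` carrier R) ?p" "?p \<noteq> []" "hd ?p = \<one>\<^bsub>?K\<^esub>"
    using c one zero K.one_not_zero by (auto simp: polynomial_def K.monom_def)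
  ultimately show ?thesis unfolding integral_over_def by blast
qed

text \<open>
  The fraction \<open>a / b\<close> is the root; it lies in the normalization because it is integral.
\<close>
lemma residue_power_in_normalization:
  fixes f g :: "'k::field fps2"
  assumes f: "Factorial_Ring.irreducible f" and q: "0 < q"
    and b: "\<not> f dvd b" and ab: "f dvd a ^ q - g * b ^ q"
  shows "\<exists>s \<in> carrier (normalization (fps2_quotient f)).
    fraction_embed (fps2_quotient f) (residue_class f g) = s [^]\<^bsub>normalization (fps2_quotient f)\<^esub> q"
proof -
  let ?Q = "fps2_quotient f" and ?r = "residue_class f"
  let ?K = "fraction_field ?Q"
  interpret Q: domain ?Q by (rule domain_fps2_quotient[OF f])
  have b_power: "?r (b ^ n) \<in> carrier ?Q - {\<zero>\<^bsub>?Q\<^esub>}" for n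
  proof -
    have "\<not> f dvd b ^ n"
    proof (induction n)
      case 0
      then show ?case using f unfolding Factorial_Ring.irreducible_def by simp
    next
      case (Suc n)
      then show ?case using irreducible_imp_prime_fps2[OF f, of b "b ^ n"] b by auto
    qed
    then show ?thesis using residue_class_simps(1) residue_class_eq_zero_iff by blast
  qed
  define s where "s = fraction ?Q (?r a) (?r b)"
  have s: "s \<in> carrier ?K"
    unfolding s_def using b_power[of 1] by (intro Q.fraction_closed residue_class_simps) simp
  have s_power: "s [^]\<^bsub>?K\<^esub> n = fraction ?Q (?r (a ^ n)) (?r (b ^ n))" for n
  proof (induction n)
    case 0
    then show ?case by (simp add: fraction_field_def residue_class_simps)
  next
    case (Suc n)
    have "s [^]\<^bsub>?K\<^esub> Suc n = fraction ?Q (?r (a ^ n)) (?r (b ^ n)) \<otimes>\<^bsub>?K\<^esub> fraction ?Q (?r a) (?r b)"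
      using Suc by (simp add: s_def)
    also have "\<dots> = fraction ?Q (?r (a ^ n) \<otimes>\<^bsub>?Q\<^esub> ?r a) (?r (b ^ n) \<otimes>\<^bsub>?Q\<^esub> ?r b)"
      using b_power[of 1] b_power[of n] by (intro Q.fraction_mult residue_class_simps) simp_all
    finally show ?case by (simp add: residue_class_simps(2)[symmetric] mult.commute)
  qed
  have "?r (a ^ q) = ?r (a ^ q - g * b ^ q) \<oplus>\<^bsub>?Q\<^esub> ?r (g * b ^ q)"
    unfolding residue_class_simps(3)[symmetric] by simp
  also have "\<dots> = ?r (g * b ^ q)"
    unfolding iffD2[OF residue_class_eq_zero_iff ab] by (intro Q.l_zero residue_class_simps)
  finally have "?r g \<otimes>\<^bsub>?Q\<^esub> ?r (b ^ q) = ?r (a ^ q) \<otimes>\<^bsub>?Q\<^esub> \<one>\<^bsub>?Q\<^esub>"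
    by (simp only: residue_class_simps(2) Q.r_one[OF Q.m_closed[OF residue_class_simps(1) residue_class_simps(1)]])
  then have root: "s [^]\<^bsub>?K\<^esub> q = fraction_embed ?Q (?r g)"
    unfolding s_power fraction_embed_def
    using b_power[of q] residue_class_simps(1) by (subst Q.fraction_eq_iff) auto
  have "s \<in> carrier (normalization ?Q)"
    unfolding normalization_def using s Q.root_integral_over[OF s residue_class_simps(1) q root] by simp
  moreover have "s [^]\<^bsub>normalization ?Q\<^esub> q = s [^]\<^bsub>?K\<^esub> q"
    unfolding normalization_def by (simp add: nat_pow_def)
  ultimately show ?thesis using root by auto
qed

theorem proposition3p3:
  fixes f g :: "'k::alg_closed_field fps2" and q :: nat
  assumes "Factorial_Ring.prime q" and "q \<noteq> CHAR('k)"
    and "f \<noteq> 0" and "Factorial_Ring.irreducible f"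
    and "g \<noteq> 0" and "Factorial_Ring.irreducible g"
    and "power_mod q f g"
  shows "(\<exists>s \<in> carrier (normalization (fps2_quotient f)).
            fraction_embed (fps2_quotient f) (residue_class f g)
              = s [^]\<^bsub>normalization (fps2_quotient f)\<^esub> q) \<and>
         (\<exists>s t :: 'k fps2 fract. to_fract g - s ^ q = to_fract f * t)"
proof
  have "\<not> CHAR('k) dvd q"
    using assms(1,2) CHAR_not_1[where ?'a = 'k] unfolding prime_nat_iff by auto
  then have q: "of_nat q \<noteq> (0 :: 'k)" by (simp add: of_nat_eq_0_iff_char_dvd)
  obtain a b where ab: "\<not> f dvd b" "f dvd a ^ q - g * b ^ q"
    using power_reciprocity[OF q assms(4,6,7)] by blast
  show "\<exists>s \<in> carrier (normalization (fps2_quotient f)).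
      fraction_embed (fps2_quotient f) (residue_class f g) = s [^]\<^bsub>normalization (fps2_quotient f)\<^esub> q"
    using residue_power_in_normalization[OF assms(4) prime_gt_0_nat[OF assms(1)] ab] .
  \<comment> \<open>The same fraction serves over \<open>k[[x,y]]\<close>; its denominator is prime to \<open>f\<close>.\<close>
  obtain t where "a ^ q - g * b ^ q = f * t" using ab(2) by (rule dvdE)
  then have t: "to_fract a ^ q - to_fract g * to_fract b ^ q = to_fract f * to_fract t"
    by (simp flip: to_fract_power to_fract_mult to_fract_diff)
  have "to_fract b \<noteq> 0" using ab(1) by auto
  then have "to_fract g - (to_fract a / to_fract b) ^ q = to_fract f * (- to_fract t / to_fract b ^ q)"
    using t by (simp add: field_simps)
  then show "\<exists>s t :: 'k fps2 fract. to_fract g - s ^ q = to_fract f * t" by blast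
qed

end
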